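(* Let $A$ be a $1$-system annular diagram. Then either $A$ is a cycle (i.e. $A$ contains no squares), or $A$ has a corner on each of its two boundary paths. Equivalently: if $A$ contains at least one square, then each of its boundary paths contains a corner.
   Context: A square complex is a combinatorial 2-complex each of whose 2-cells (squares) is attached along a combinatorial map from a 4-cycle to the 1-skeleton; cubes are $[-1,1]^k$ for $k\le 2$. A midcube of a cube is the subset obtained by setting one coordinate to $0$. Gluing midcubes via the restrictions of the attaching maps gives a complex $U$; a dual curve is a connected component of $U$, it is dual to the edges whose midpoints it contains, and it is an arc if homeomorphic to an interval (possibly of length $0$), simple if its natural immersion into the complex is an embedding. An annular diagram is a finite combinatorial cell decomposition of $S^2$ minus two disjoint open 2-cells; the attaching maps of these two removed 2-cells are the two boundary paths. A (square annular) diagram is an annular diagram that is also a square complex. A $k$-system annular diagram is a square annular diagram whose dual curves are all simple arcs joining the two boundary paths, with any two dual curves intersecting in at most $k$ squares. A corner on a boundary path $P$ is a vertex of $P$ of degree $2$ (number of incident edges, loops counted twice) that is contained in some square. *)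

theory Defs
  imports Main
begin

text \<open>
  Combinatorial model of a square annular diagram.
  A finite cell decomposition of the 2-sphere with connected 1-skeleton is encoded
  as an (orientable) combinatorial map: a finite set of darts D (half-edges),
  a fixed-point-free involution alpha (the two darts of an edge), and a permutation
  sigma (cyclic rotation of darts around a vertex).  Vertices are sigma-orbits,
  edges are alpha-orbits, and 2-cells are orbits of phi = sigma o alpha; the orbit of
  a dart d under phi is the closed boundary walk of the 2-cell containing d
  (dart d runs from the vertex of d to the vertex of alpha d).  The surface is the
  sphere iff the map is connected and V - E + F = 2.
  An annular diagram is obtained by removing two distinct 2-cells B1, B2
  (their boundary walks are the two boundary paths); it is a square annular
  diagram when all remaining 2-cells have boundary length 4 (squares).
\<close>

definition orb :: "('d \<Rightarrow> 'd) \<Rightarrow> 'd \<Rightarrow> 'd set" where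
  "orb f x = range (\<lambda>n. (f ^^ n) x)"

definition phi :: "('d \<Rightarrow> 'd) \<Rightarrow> ('d \<Rightarrow> 'd) \<Rightarrow> 'd \<Rightarrow> 'd" where
  "phi \<alpha> \<sigma> = \<sigma> \<circ> \<alpha>"

definition verts :: "'d set \<Rightarrow> ('d \<Rightarrow> 'd) \<Rightarrow> 'd set set" where
  "verts D \<sigma> = orb \<sigma> ` D"

definition edges :: "'d set \<Rightarrow> ('d \<Rightarrow> 'd) \<Rightarrow> 'd set set" where
  "edges D \<alpha> = orb \<alpha> ` D"

definition cells :: "'d set \<Rightarrow> ('d \<Rightarrow> 'd) \<Rightarrow> ('d \<Rightarrow> 'd) \<Rightarrow> 'd set set" where
  "cells D \<alpha> \<sigma> = orb (phi \<alpha> \<sigma>) ` D"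

text \<open>Finite connected combinatorial map whose surface is the 2-sphere.\<close>
definition sphere_map :: "'d set \<Rightarrow> ('d \<Rightarrow> 'd) \<Rightarrow> ('d \<Rightarrow> 'd) \<Rightarrow> bool" where
  "sphere_map D \<alpha> \<sigma> \<longleftrightarrow>
     finite D \<and>
     bij_betw \<alpha> D D \<and> (\<forall>d\<in>D. \<alpha> (\<alpha> d) = d \<and> \<alpha> d \<noteq> d) \<and>
     bij_betw \<sigma> D D \<and>
     (\<forall>d\<in>D. \<forall>d'\<in>D. (d, d') \<in> {(x, y). y = \<alpha> x \<or> y = \<sigma> x}\<^sup>*) \<and>
     int (card (verts D \<sigma>)) - int (card (edges D \<alpha>)) + int (card (cells D \<alpha> \<sigma>)) = 2"

text \<open>The 2-cells of the annular diagram: all cells of the sphere except B1, B2.\<close>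
definition squares :: "'d set \<Rightarrow> ('d \<Rightarrow> 'd) \<Rightarrow> ('d \<Rightarrow> 'd) \<Rightarrow> 'd set \<Rightarrow> 'd set \<Rightarrow> 'd set set" where
  "squares D \<alpha> \<sigma> B1 B2 = cells D \<alpha> \<sigma> - {B1, B2}"

definition square_annular_diagram ::
  "'d set \<Rightarrow> ('d \<Rightarrow> 'd) \<Rightarrow> ('d \<Rightarrow> 'd) \<Rightarrow> 'd set \<Rightarrow> 'd set \<Rightarrow> bool" where
  "square_annular_diagram D \<alpha> \<sigma> B1 B2 \<longleftrightarrow>
     sphere_map D \<alpha> \<sigma> \<and> B1 \<in> cells D \<alpha> \<sigma> \<and> B2 \<in> cells D \<alpha> \<sigma> \<and> B1 \<noteq> B2 \<and>
     (\<forall>s \<in> squares D \<alpha> \<sigma> B1 B2. card s = 4)"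

text \<open>Midcubes of squares: the square with boundary walk d, phi d, phi^2 d, phi^3 d
  has two midcubes, joining the midpoints of the edges of d and phi^2 d, resp. of
  phi d and phi^3 d; a midcube is recorded as the pair of darts {d, phi^2 d}.\<close>
definition midcubes :: "'d set \<Rightarrow> ('d \<Rightarrow> 'd) \<Rightarrow> ('d \<Rightarrow> 'd) \<Rightarrow> 'd set \<Rightarrow> 'd set \<Rightarrow> 'd set set" where
  "midcubes D \<alpha> \<sigma> B1 B2 =
     {{d, (phi \<alpha> \<sigma> ^^ 2) d} | d. d \<in> D \<and> orb (phi \<alpha> \<sigma>) d \<in> squares D \<alpha> \<sigma> B1 B2}"

text \<open>Square containing a midcube.\<close>
definition mc_in_square :: "('d \<Rightarrow> 'd) \<Rightarrow> ('d \<Rightarrow> 'd) \<Rightarrow> 'd set \<Rightarrow> 'd set \<Rightarrow> bool" where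
  "mc_in_square \<alpha> \<sigma> m s \<longleftrightarrow> (\<exists>d\<in>m. orb (phi \<alpha> \<sigma>) d = s)"

text \<open>Midcube m is incident (at an endpoint) to the midpoint of edge e.\<close>
definition mc_at :: "('d \<Rightarrow> 'd) \<Rightarrow> 'd set \<Rightarrow> 'd set \<Rightarrow> bool" where
  "mc_at \<alpha> m e \<longleftrightarrow> (\<exists>d\<in>m. orb \<alpha> d = e)"

text \<open>Adjacency in the graph U of glued midcubes: vertices are (midpoints of) edges,
  and each midcube is a U-edge joining the edges at its two ends.\<close>
definition U_adj :: "'d set \<Rightarrow> ('d \<Rightarrow> 'd) \<Rightarrow> ('d \<Rightarrow> 'd) \<Rightarrow> 'd set \<Rightarrow> 'd set \<Rightarrow> 'd set \<Rightarrow> 'd set \<Rightarrow> bool" where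
  "U_adj D \<alpha> \<sigma> B1 B2 e e' \<longleftrightarrow>
     (\<exists>m \<in> midcubes D \<alpha> \<sigma> B1 B2. mc_at \<alpha> m e \<and> mc_at \<alpha> m e')"

text \<open>Dual curves (connected components of U), given by their set of edges.\<close>
definition dual_curves :: "'d set \<Rightarrow> ('d \<Rightarrow> 'd) \<Rightarrow> ('d \<Rightarrow> 'd) \<Rightarrow> 'd set \<Rightarrow> 'd set \<Rightarrow> 'd set set set" where
  "dual_curves D \<alpha> \<sigma> B1 B2 =
     (\<lambda>e. {e' \<in> edges D \<alpha>. (U_adj D \<alpha> \<sigma> B1 B2)\<^sup>*\<^sup>* e e'}) ` edges D \<alpha>"

text \<open>The midcubes (U-edges) of the dual curve with edge set C.\<close>
definition curve_mcs :: "'d set \<Rightarrow> ('d \<Rightarrow> 'd) \<Rightarrow> ('d \<Rightarrow> 'd) \<Rightarrow> 'd set \<Rightarrow> 'd set \<Rightarrow> 'd set set \<Rightarrow> 'd set set" where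
  "curve_mcs D \<alpha> \<sigma> B1 B2 C = {m \<in> midcubes D \<alpha> \<sigma> B1 B2. \<exists>e\<in>C. mc_at \<alpha> m e}"

definition curve_deg :: "'d set \<Rightarrow> ('d \<Rightarrow> 'd) \<Rightarrow> ('d \<Rightarrow> 'd) \<Rightarrow> 'd set \<Rightarrow> 'd set \<Rightarrow> 'd set set \<Rightarrow> 'd set \<Rightarrow> nat" where
  "curve_deg D \<alpha> \<sigma> B1 B2 C e = card {m \<in> curve_mcs D \<alpha> \<sigma> B1 B2 C. mc_at \<alpha> m e}"

text \<open>A (connected, finite) dual curve is an arc iff it is a tree (|U-edges| = |vertices| - 1,
  loops and multiple U-edges counted) with all degrees at most 2, i.e. a path,
  possibly a single vertex (arc of length 0).\<close>
definition is_arc :: "'d set \<Rightarrow> ('d \<Rightarrow> 'd) \<Rightarrow> ('d \<Rightarrow> 'd) \<Rightarrow> 'd set \<Rightarrow> 'd set \<Rightarrow> 'd set set \<Rightarrow> bool" where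
  "is_arc D \<alpha> \<sigma> B1 B2 C \<longleftrightarrow>
     card (curve_mcs D \<alpha> \<sigma> B1 B2 C) + 1 = card C \<and>
     (\<forall>e\<in>C. curve_deg D \<alpha> \<sigma> B1 B2 C e \<le> 2)"

text \<open>The immersion of a dual curve is an embedding iff no two of its midcubes lie in
  the same square (otherwise the curve crosses itself at that square's centre).\<close>
definition is_simple :: "'d set \<Rightarrow> ('d \<Rightarrow> 'd) \<Rightarrow> ('d \<Rightarrow> 'd) \<Rightarrow> 'd set \<Rightarrow> 'd set \<Rightarrow> 'd set set \<Rightarrow> bool" where
  "is_simple D \<alpha> \<sigma> B1 B2 C \<longleftrightarrow>
     (\<forall>m1 \<in> curve_mcs D \<alpha> \<sigma> B1 B2 C. \<forall>m2 \<in> curve_mcs D \<alpha> \<sigma> B1 B2 C. \<forall>s.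
        mc_in_square \<alpha> \<sigma> m1 s \<and> mc_in_square \<alpha> \<sigma> m2 s \<longrightarrow> m1 = m2)"

text \<open>Edges of a boundary path (boundary walk of the removed cell B).\<close>
definition bd_edges :: "('d \<Rightarrow> 'd) \<Rightarrow> 'd set \<Rightarrow> 'd set set" where
  "bd_edges \<alpha> B = orb \<alpha> ` B"

text \<open>Endpoints of an arc: its vertices of U-degree at most 1.\<close>
definition arc_ends :: "'d set \<Rightarrow> ('d \<Rightarrow> 'd) \<Rightarrow> ('d \<Rightarrow> 'd) \<Rightarrow> 'd set \<Rightarrow> 'd set \<Rightarrow> 'd set set \<Rightarrow> 'd set set" where
  "arc_ends D \<alpha> \<sigma> B1 B2 C = {e \<in> C. curve_deg D \<alpha> \<sigma> B1 B2 C e \<le> 1}"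

definition joins_boundaries :: "'d set \<Rightarrow> ('d \<Rightarrow> 'd) \<Rightarrow> ('d \<Rightarrow> 'd) \<Rightarrow> 'd set \<Rightarrow> 'd set \<Rightarrow> 'd set set \<Rightarrow> bool" where
  "joins_boundaries D \<alpha> \<sigma> B1 B2 C \<longleftrightarrow>
     (\<exists>e1 e2. arc_ends D \<alpha> \<sigma> B1 B2 C = {e1, e2} \<and> e1 \<in> bd_edges \<alpha> B1 \<and> e2 \<in> bd_edges \<alpha> B2)"

text \<open>Squares in which two dual curves intersect.\<close>
definition meet_squares :: "'d set \<Rightarrow> ('d \<Rightarrow> 'd) \<Rightarrow> ('d \<Rightarrow> 'd) \<Rightarrow> 'd set \<Rightarrow> 'd set \<Rightarrow> 'd set set \<Rightarrow> 'd set set \<Rightarrow> 'd set set" where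
  "meet_squares D \<alpha> \<sigma> B1 B2 C1 C2 =
     {s \<in> squares D \<alpha> \<sigma> B1 B2.
        (\<exists>m1 \<in> curve_mcs D \<alpha> \<sigma> B1 B2 C1. mc_in_square \<alpha> \<sigma> m1 s) \<and>
        (\<exists>m2 \<in> curve_mcs D \<alpha> \<sigma> B1 B2 C2. mc_in_square \<alpha> \<sigma> m2 s)}"

definition k_system_annular_diagram ::
  "nat \<Rightarrow> 'd set \<Rightarrow> ('d \<Rightarrow> 'd) \<Rightarrow> ('d \<Rightarrow> 'd) \<Rightarrow> 'd set \<Rightarrow> 'd set \<Rightarrow> bool" where
  "k_system_annular_diagram k D \<alpha> \<sigma> B1 B2 \<longleftrightarrow>
     square_annular_diagram D \<alpha> \<sigma> B1 B2 \<and>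
     (\<forall>C \<in> dual_curves D \<alpha> \<sigma> B1 B2.
        is_arc D \<alpha> \<sigma> B1 B2 C \<and> is_simple D \<alpha> \<sigma> B1 B2 C \<and> joins_boundaries D \<alpha> \<sigma> B1 B2 C) \<and>
     (\<forall>C1 \<in> dual_curves D \<alpha> \<sigma> B1 B2. \<forall>C2 \<in> dual_curves D \<alpha> \<sigma> B1 B2.
        C1 \<noteq> C2 \<longrightarrow> card (meet_squares D \<alpha> \<sigma> B1 B2 C1 C2) \<le> k)"

text \<open>A corner on the boundary path of B: a vertex of the path of degree 2
  (number of darts at it, so loops count twice) lying in some square.\<close>
definition has_corner_on ::
  "'d set \<Rightarrow> ('d \<Rightarrow> 'd) \<Rightarrow> ('d \<Rightarrow> 'd) \<Rightarrow> 'd set \<Rightarrow> 'd set \<Rightarrow> 'd set \<Rightarrow> bool" where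
  "has_corner_on D \<alpha> \<sigma> B1 B2 B \<longleftrightarrow>
     (\<exists>v \<in> verts D \<sigma>. (\<exists>d\<in>B. orb \<sigma> d = v) \<and> card v = 2 \<and>
        (\<exists>s \<in> squares D \<alpha> \<sigma> B1 B2. \<exists>d\<in>s. orb \<sigma> d = v))"

end

theory Submission
  imports Defs
begin

text \<open>
  A pair of strands \<open>x\<close>, \<open>y\<close> starting at the boundary path \<open>B1\<close> such that \<open>x\<close> is the strand
  crossed by \<open>y\<close> in its first square cuts off a triangle with base on \<open>B1\<close>. If \<open>y\<close> is also the
  strand crossed by \<open>x\<close> in its first square, no strand can escape from the base of the triangle,
  so the base is trivial and the apex square has a corner there. Otherwise let \<open>z\<close> be the strand
  crossed by \<open>x\<close> in its first square. It cannot cross \<open>x\<close> again and does not meet the side on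
  \<open>y\<close>, so it starts inside the base, and the triangle cut off by \<open>z\<close> and \<open>x\<close> has a strictly
  smaller base. Descent on the size of the base yields the corner.

  Inside and outside of a triangle are given by a mod 2 potential on the vertices that switches
  exactly across its sides. It exists because \<open>V - E + F = 2\<close> makes the first cohomology group with
  coefficients in \<open>\<int>/2\<close> vanish, as one sees by counting cocycles and coboundaries.
\<close>

section \<open>Orbits and parity\<close>

lemma orb_self: "x \<in> orb f x"
  unfolding orb_def by (metis funpow_0 rangeI)

lemma orb_step: "y \<in> orb f x \<Longrightarrow> f y \<in> orb f x"
proof -
  assume "y \<in> orb f x"
  then obtain n where "y = (f ^^ n) x" unfolding orb_def by blast
  then have "f y = (f ^^ Suc n) x" by simp
  then show ?thesis unfolding orb_def by blast
qed

lemma funpow_in: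
  assumes "bij_betw f D D" "x \<in> D" shows "(f ^^ n) x \<in> D"
  using assms by (induction n) (auto simp: bij_betw_def)

lemma orb_subset:
  assumes "bij_betw f D D" "x \<in> D" shows "orb f x \<subseteq> D"
  using funpow_in[OF assms] by (auto simp: orb_def)

lemma funpow_cancel:
  assumes "bij_betw f D D" "x \<in> D" "y \<in> D" "(f ^^ n) x = (f ^^ n) y"
  shows "x = y"
  using assms(4)
proof (induction n)
  case (Suc n)
  then show ?case
    using assms(1) funpow_in[OF assms(1,2)] funpow_in[OF assms(1,3)]
    by (auto simp: bij_betw_def dest: inj_onD)
qed simp

lemma funpow_diff_cancel:
  assumes "bij_betw f D D" "x \<in> D" "(f ^^ i) x = (f ^^ j) x" "i \<le> j"
  shows "(f ^^ (j - i)) x = x"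
proof -
  have "(f ^^ (i + (j - i))) x = (f ^^ i) ((f ^^ (j - i)) x)"
    unfolding funpow_add by simp
  then have "(f ^^ i) ((f ^^ (j - i)) x) = (f ^^ i) x"
    using assms(3,4) by simp
  then show ?thesis
    by (rule funpow_cancel[OF assms(1) funpow_in[OF assms(1,2)] assms(2)])
qed

text \<open>The period is the least positive \<open>p\<close> with \<open>(f ^^ p) x = x\<close>:
  minimality makes the first \<open>p\<close> iterates distinct, and reducing exponents modulo
  \<open>p\<close> shows that they exhaust the orbit.\<close>

lemma orb_cycle:
  assumes "finite D" "bij_betw f D D" "x \<in> D"
  defines "n \<equiv> card (orb f x)"
  shows "n > 0" "(f ^^ n) x = x" "inj_on (\<lambda>i. (f ^^ i) x) {..<n}"
    "orb f x = (\<lambda>i. (f ^^ i) x) ` {..<n}"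
proof -
  have "\<not> inj (\<lambda>i. (f ^^ i) x)"
  proof
    assume "inj (\<lambda>i. (f ^^ i) x)"
    moreover have "finite (range (\<lambda>i. (f ^^ i) x))"
      using assms(1) funpow_in[OF assms(2,3)] by (auto intro: finite_subset)
    ultimately show False using finite_imageD by blast
  qed
  then obtain i j where "i < j" and eq: "(f ^^ i) x = (f ^^ j) x"
    unfolding inj_def by (metis linorder_neqE_nat)
  have per: "(f ^^ (j - i)) x = x"
    using funpow_diff_cancel[OF assms(2,3) eq] \<open>i < j\<close> by simp
  define p where "p = (LEAST p. p > 0 \<and> (f ^^ p) x = x)"
  have ex: "j - i > 0 \<and> (f ^^ (j - i)) x = x"
    using per \<open>i < j\<close> by simp
  have p: "p > 0" "(f ^^ p) x = x"
    using LeastI[of "\<lambda>p. p > 0 \<and> (f ^^ p) x = x", OF ex] unfolding p_def by auto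
  have least: "(f ^^ q) x \<noteq> x" if "0 < q" "q < p" for q
    using not_less_Least[of q "\<lambda>p. p > 0 \<and> (f ^^ p) x = x"] that unfolding p_def by auto
  have inj: "inj_on (\<lambda>i. (f ^^ i) x) {..<p}"
  proof (rule linorder_inj_onI)
    fix a b assume ab: "a < b" "a \<in> {..<p}" "b \<in> {..<p}"
    show "(f ^^ a) x \<noteq> (f ^^ b) x"
    proof
      assume "(f ^^ a) x = (f ^^ b) x"
      then have "(f ^^ (b - a)) x = x"
        using funpow_diff_cancel[OF assms(2,3)] ab by simp
      moreover have "0 < b - a" "b - a < p" using ab by auto
      ultimately show False using least by blast
    qed
  qed auto
  have "orb f x \<subseteq> (\<lambda>i. (f ^^ i) x) ` {..<p}"
  proof
    fix y assume "y \<in> orb f x"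
    then obtain q where "y = (f ^^ q) x" by (auto simp: orb_def)
    then have "y = (f ^^ (q mod p)) x"
      using funpow_mod_eq[OF p(2)] by simp
    then show "y \<in> (\<lambda>i. (f ^^ i) x) ` {..<p}" using p(1) by auto
  qed
  then have orb: "orb f x = (\<lambda>i. (f ^^ i) x) ` {..<p}"
    by (auto simp: orb_def)
  then have np: "n = p"
    unfolding n_def using inj by (simp add: card_image)
  show "n > 0" "(f ^^ n) x = x" "inj_on (\<lambda>i. (f ^^ i) x) {..<n}"
    "orb f x = (\<lambda>i. (f ^^ i) x) ` {..<n}"
    unfolding np by (fact p inj orb)+
qed

lemma orb_eq:
  assumes "finite D" "bij_betw f D D" "x \<in> D" "y \<in> orb f x"
  shows "orb f y = orb f x"
proof -
  let ?n = "card (orb f x)"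
  obtain i where i: "i < ?n" "y = (f ^^ i) x"
    using orb_cycle(4)[OF assms(1-3)] assms(4) by blast
  have "(f ^^ (?n - i + i)) x = (f ^^ (?n - i)) y"
    unfolding funpow_add using i by simp
  then have "x = (f ^^ (?n - i)) y"
    using orb_cycle(2)[OF assms(1-3)] i by simp
  then have x: "x \<in> orb f y" by (auto simp: orb_def)
  have "orb f b \<subseteq> orb f a" if "b \<in> orb f a" for a b
  proof -
    from that obtain q where "b = (f ^^ q) a" unfolding orb_def by blast
    then have "(f ^^ p) b = (f ^^ (p + q)) a" for p by (simp add: funpow_add)
    then show ?thesis by (auto simp: orb_def)
  qed
  then show ?thesis using x assms(4) by blast
qed

section \<open>Parity of finite sets, with symmetric difference as addition mod 2\<close>

abbreviation sdiff :: "'a set \<Rightarrow> 'a set \<Rightarrow> 'a set" where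
  "sdiff A B \<equiv> (A - B) \<union> (B - A)"

lemma odd_card_sdiff:
  assumes "finite A" "finite B"
  shows "odd (card (sdiff A B)) \<longleftrightarrow> (odd (card A) \<noteq> odd (card B))"
proof -
  have "card (sdiff A B) = card (A - B) + card (B - A)"
    using assms by (intro card_Un_disjoint) auto
  moreover have "card A = card (A - B) + card (A \<inter> B)"
    using card_Int_Diff[OF assms(1), of B] by simp
  moreover have "card B = card (B - A) + card (A \<inter> B)"
    using card_Int_Diff[OF assms(2), of A] by (simp add: Int_commute)
  ultimately show ?thesis by (cases "even (card (A - B))"; cases "even (card (B - A))"; simp)
qed

text \<open>\<open>f\<close> maps the set where \<open>g (f d)\<close> holds bijectively onto the
  set where \<open>g\<close> holds, and two sets of equal size have a symmetric difference of even
  size.\<close>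

lemma even_card_changes:
  fixes g :: "'a \<Rightarrow> bool"
  assumes "finite c" "bij_betw f c c"
  shows "even (card {d \<in> c. g d \<noteq> g (f d)})"
proof -
  let ?A = "{d \<in> c. g d}" and ?B = "{d \<in> c. g (f d)}"
  have "bij_betw f ?B ?A"
    using assms(2) unfolding bij_betw_def by (auto simp: inj_on_def)
  then have "card ?A = card ?B" by (simp add: bij_betw_same_card)
  moreover have "{d \<in> c. g d \<noteq> g (f d)} = sdiff ?A ?B" by auto
  ultimately show ?thesis
    using odd_card_sdiff[of ?A ?B] assms(1) by auto
qed

lemma odd_card_Int_pair:
  assumes "a \<noteq> b" shows "odd (card (c \<inter> {a, b})) \<longleftrightarrow> (a \<in> c) \<noteq> (b \<in> c)"
  using assms by (cases "a \<in> c"; cases "b \<in> c") (auto simp: Int_insert_right)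

text \<open>Meant for a potential read along a boundary path, which one dart other than the starting
  dart switches. Index 0 is left out because the starting dart switches it too.\<close>

lemma switch_once:
  fixes f :: "nat \<Rightarrow> bool"
  assumes "\<And>i. 0 < i \<Longrightarrow> i < n \<Longrightarrow> f (Suc i) \<longleftrightarrow> (f i \<noteq> (i = q))"
    and "0 < q" "0 < i" "i \<le> n"
  shows "f i \<longleftrightarrow> (f 1 \<noteq> (q < i))"
  using assms(3,4)
proof (induction i)
  case (Suc i)
  show ?case
  proof (cases "i = 0")
    case False
    then have "f i \<longleftrightarrow> (f 1 \<noteq> (q < i))" "f (Suc i) \<longleftrightarrow> (f i \<noteq> (i = q))"
      using Suc assms(1)[of i] by simp_all
    then show ?thesis by (cases "i = q"; cases "q < i") auto
  qed (use assms(2) in simp)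
qed simp

section \<open>Mod 2 cohomology of the sphere\<close>

locale sphere =
  fixes D :: "'d set" and \<alpha> \<sigma> :: "'d \<Rightarrow> 'd"
  assumes sphere: "sphere_map D \<alpha> \<sigma>"
begin

abbreviation \<phi> :: "'d \<Rightarrow> 'd" where "\<phi> \<equiv> phi \<alpha> \<sigma>"

lemma fin: "finite D"
  and bij_\<alpha>: "bij_betw \<alpha> D D" and bij_\<sigma>: "bij_betw \<sigma> D D"
  and \<alpha>\<alpha> [simp]: "d \<in> D \<Longrightarrow> \<alpha> (\<alpha> d) = d" and \<alpha>_neq: "d \<in> D \<Longrightarrow> \<alpha> d \<noteq> d"
  and conn: "d \<in> D \<Longrightarrow> d' \<in> D \<Longrightarrow> (d, d') \<in> {(x, y). y = \<alpha> x \<or> y = \<sigma> x}\<^sup>*"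
  and euler: "card (verts D \<sigma>) + card (cells D \<alpha> \<sigma>) = card (edges D \<alpha>) + 2"
  using sphere unfolding sphere_map_def by auto

lemma \<alpha>_in [simp]: "d \<in> D \<Longrightarrow> \<alpha> d \<in> D" and \<sigma>_in [simp]: "d \<in> D \<Longrightarrow> \<sigma> d \<in> D"
  using bij_\<alpha> bij_\<sigma> by (auto simp: bij_betw_def)

lemma bij_\<phi>: "bij_betw \<phi> D D"
  unfolding phi_def by (rule bij_betw_trans[OF bij_\<alpha> bij_\<sigma>])

lemma \<phi>_in [simp]: "d \<in> D \<Longrightarrow> \<phi> d \<in> D"
  using bij_\<phi> by (auto simp: bij_betw_def)

lemma \<phi>\<alpha>: "d \<in> D \<Longrightarrow> \<phi> (\<alpha> d) = \<sigma> d"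
  by (simp add: phi_def)

lemma orb_\<alpha>: "d \<in> D \<Longrightarrow> orb \<alpha> d = {d, \<alpha> d}"
proof -
  assume d: "d \<in> D"
  have "(\<alpha> ^^ n) d \<in> {d, \<alpha> d}" for n
    using d by (induction n) auto
  then show ?thesis
    using orb_self[of d \<alpha>] orb_step[of d \<alpha> d] by (auto simp: orb_def)
qed

lemma orb_\<alpha>_eq_iff: "d \<in> D \<Longrightarrow> d' \<in> D \<Longrightarrow> orb \<alpha> d = orb \<alpha> d' \<longleftrightarrow> d' = d \<or> d' = \<alpha> d"
  by (auto simp: orb_\<alpha> doubleton_eq_iff)

lemma orb_\<phi>_eq: "d \<in> D \<Longrightarrow> e \<in> orb \<phi> d \<Longrightarrow> orb \<phi> e = orb \<phi> d"
  using orb_eq[OF fin bij_\<phi>] by blast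

lemma orb_\<phi>_step: "d \<in> D \<Longrightarrow> orb \<phi> (\<phi> d) = orb \<phi> d"
  by (intro orb_\<phi>_eq orb_step orb_self)

lemma orb_\<sigma>_step: "d \<in> D \<Longrightarrow> orb \<sigma> (\<sigma> d) = orb \<sigma> d"
  by (intro orb_eq[OF fin bij_\<sigma>] orb_step orb_self)

lemma cell_subset: "c \<in> cells D \<alpha> \<sigma> \<Longrightarrow> c \<subseteq> D"
  using orb_subset[OF bij_\<phi>] by (auto simp: cells_def)

lemma cell_orb: "c \<in> cells D \<alpha> \<sigma> \<Longrightarrow> d \<in> c \<Longrightarrow> orb \<phi> d = c"
  using orb_\<phi>_eq by (auto simp: cells_def)

lemma cell_\<phi>: "c \<in> cells D \<alpha> \<sigma> \<Longrightarrow> d \<in> c \<Longrightarrow> \<phi> d \<in> c"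
  using orb_step by (auto simp: cells_def)

lemma bij_\<phi>_cell: assumes "c \<in> cells D \<alpha> \<sigma>" shows "bij_betw \<phi> c c"
proof -
  have "inj_on \<phi> c"
    using bij_\<phi> cell_subset[OF assms] by (meson bij_betw_def inj_on_subset)
  moreover have "\<phi> ` c \<subseteq> c" using cell_\<phi>[OF assms] by auto
  moreover have "finite c" using cell_subset[OF assms] fin finite_subset by blast
  ultimately show ?thesis by (simp add: bij_betw_def endo_inj_surj)
qed

lemma cell_disjoint:
  "c \<in> cells D \<alpha> \<sigma> \<Longrightarrow> c' \<in> cells D \<alpha> \<sigma> \<Longrightarrow> d \<in> c \<Longrightarrow> d \<in> c' \<Longrightarrow> c = c'"
  using cell_orb by metis

lemma conn_induct:
  assumes "d0 \<in> D" "d \<in> D" and base: "P d0"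
    and step: "\<And>x. x \<in> D \<Longrightarrow> P x \<Longrightarrow> P (\<alpha> x)" "\<And>x. x \<in> D \<Longrightarrow> P x \<Longrightarrow> P (\<sigma> x)"
  shows "P d"
proof -
  have "d \<in> D \<and> P d"
    using conn[OF assms(1,2)]
    by (induction rule: rtrancl_induct) (use assms in auto)
  then show ?thesis ..
qed

section \<open>Mod 2 cochains as sets of edges\<close>

definition darts_of :: "'d set set \<Rightarrow> 'd set" where
  "darts_of X = {d \<in> D. orb \<alpha> d \<in> X}"

lemma darts_of_sdiff: "c \<inter> darts_of (sdiff X Y) = sdiff (c \<inter> darts_of X) (c \<inter> darts_of Y)"
  by (auto simp: darts_of_def)

lemma finite_darts_of: "finite (c \<inter> darts_of X)"
  using fin by (auto simp: darts_of_def)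

lemma odd_darts_of_sdiff:
  "odd (card (c \<inter> darts_of (sdiff X Y))) \<longleftrightarrow>
   (odd (card (c \<inter> darts_of X)) \<noteq> odd (card (c \<inter> darts_of Y)))"
  unfolding darts_of_sdiff by (intro odd_card_sdiff finite_darts_of)

lemma darts_of_edge: "d \<in> D \<Longrightarrow> darts_of {orb \<alpha> d} = {d, \<alpha> d}"
proof -
  assume d: "d \<in> D"
  have "e \<in> darts_of {orb \<alpha> d} \<longleftrightarrow> e \<in> {d, \<alpha> d}" for e
    using orb_\<alpha>_eq_iff[OF d, of e] d unfolding darts_of_def by (auto simp del: \<alpha>\<alpha>)
  then show ?thesis by blast
qed

text \<open>Parity is taken over darts, not edges, so an edge with the same cell on both sides
  contributes twice and cancels.\<close>

definition cocycles :: "'d set set set" where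
  "cocycles = {X. X \<subseteq> edges D \<alpha> \<and> (\<forall>c \<in> cells D \<alpha> \<sigma>. even (card (c \<inter> darts_of X)))}"

text \<open>This is the cut of the vertex set \<open>W\<close>: the edges with exactly one end in
  \<open>W\<close>.\<close>

definition coboundary :: "'d set set \<Rightarrow> 'd set set" where
  "coboundary W = orb \<alpha> ` {d \<in> D. (orb \<sigma> d \<in> W) \<noteq> (orb \<sigma> (\<alpha> d) \<in> W)}"

lemma darts_of_coboundary:
  "darts_of (coboundary W) = {d \<in> D. (orb \<sigma> d \<in> W) \<noteq> (orb \<sigma> (\<alpha> d) \<in> W)}"
proof -
  have "(orb \<sigma> d \<in> W) \<noteq> (orb \<sigma> (\<alpha> d) \<in> W)"
    if "d \<in> D" "d' \<in> D" "orb \<alpha> d = orb \<alpha> d'" "(orb \<sigma> d' \<in> W) \<noteq> (orb \<sigma> (\<alpha> d') \<in> W)" for d d'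
    using that orb_\<alpha>_eq_iff[of d d'] by auto
  then show ?thesis
    unfolding darts_of_def coboundary_def by blast
qed

text \<open>On a walk around a cell, membership of the current vertex in \<open>W\<close> changes an
  even number of times.\<close>

lemma coboundary_cocycle: "coboundary W \<in> cocycles"
  unfolding cocycles_def
proof (intro CollectI conjI ballI)
  show "coboundary W \<subseteq> edges D \<alpha>" by (auto simp: coboundary_def edges_def)
  fix c assume c: "c \<in> cells D \<alpha> \<sigma>"
  have "orb \<sigma> (\<alpha> d) = orb \<sigma> (\<phi> d)" if "d \<in> D" for d
    using that orb_\<sigma>_step[of "\<alpha> d"] by (simp add: phi_def)
  then have "c \<inter> darts_of (coboundary W) = {d \<in> c. (orb \<sigma> d \<in> W) \<noteq> (orb \<sigma> (\<phi> d) \<in> W)}"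
    unfolding darts_of_coboundary using cell_subset[OF c] by auto
  moreover have "finite c" using cell_subset[OF c] fin by (rule finite_subset)
  ultimately show "even (card (c \<inter> darts_of (coboundary W)))"
    using even_card_changes[OF _ bij_\<phi>_cell[OF c], of "\<lambda>d. orb \<sigma> d \<in> W"] by simp
qed

text \<open>A vertex set and its complement have the same cut; leaving out the vertex of
  \<open>d0\<close> selects one of the two. Agreement at that vertex spreads along edges by
  connectedness.\<close>

lemma coboundary_inj:
  assumes "d0 \<in> D"
  shows "inj_on coboundary (Pow (verts D \<sigma> - {orb \<sigma> d0}))"
proof
  fix W W' assume W: "W \<in> Pow (verts D \<sigma> - {orb \<sigma> d0})" "W' \<in> Pow (verts D \<sigma> - {orb \<sigma> d0})"
    and eq: "coboundary W = coboundary W'"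
  have "orb \<sigma> d \<in> W \<longleftrightarrow> orb \<sigma> d \<in> W'" if "d \<in> D" for d
  proof (rule conn_induct[OF assms that])
    show "orb \<sigma> d0 \<in> W \<longleftrightarrow> orb \<sigma> d0 \<in> W'" using W by blast
  next
    fix x assume x: "x \<in> D" "orb \<sigma> x \<in> W \<longleftrightarrow> orb \<sigma> x \<in> W'"
    have "x \<in> darts_of (coboundary W) \<longleftrightarrow> x \<in> darts_of (coboundary W')" by (simp add: eq)
    then show "orb \<sigma> (\<alpha> x) \<in> W \<longleftrightarrow> orb \<sigma> (\<alpha> x) \<in> W'"
      using x unfolding darts_of_coboundary by blast
  qed (simp add: orb_\<sigma>_step)
  then show "W = W'" using W by (auto simp: verts_def)
qed

text \<open>Dual paths to a base cell realise every prescribed parity pattern on the other cells.\<close>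
lemma ex_parity:
  assumes d0: "d0 \<in> D" and Y: "Y \<subseteq> cells D \<alpha> \<sigma> - {orb \<phi> d0}"
  shows "\<exists>X \<subseteq> edges D \<alpha>. \<forall>c \<in> cells D \<alpha> \<sigma> - {orb \<phi> d0}.
           odd (card (c \<inter> darts_of X)) \<longleftrightarrow> c \<in> Y"
proof -
  let ?F = "cells D \<alpha> \<sigma> - {orb \<phi> d0}"
  define real where "real X y \<longleftrightarrow> (\<forall>c \<in> ?F. odd (card (c \<inter> darts_of X)) \<longleftrightarrow> c = y)" for X y
  have step: "\<exists>X \<subseteq> edges D \<alpha>. real X (orb \<phi> (\<alpha> x))"
    if x: "x \<in> D" and IH: "\<exists>X \<subseteq> edges D \<alpha>. real X (orb \<phi> x)" for x
  proof -
    obtain X where X: "X \<subseteq> edges D \<alpha>" "real X (orb \<phi> x)"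
      using IH by blast
    \<comment> \<open>Adding the edge of \<open>x\<close> flips the parity of the cells on its two
      sides, which moves the odd cell from that of \<open>x\<close> to that of
      \<open>\<alpha> x\<close>; nothing changes when the two coincide.\<close>
    have "odd (card (c \<inter> darts_of (sdiff X {orb \<alpha> x}))) \<longleftrightarrow> c = orb \<phi> (\<alpha> x)" if c: "c \<in> ?F" for c
    proof -
      have mem: "y \<in> c \<longleftrightarrow> c = orb \<phi> y" for y
        using cell_orb[of c y] c orb_self[of y \<phi>] by auto
      have "odd (card (c \<inter> {x, \<alpha> x})) \<longleftrightarrow> ((x \<in> c) \<noteq> (\<alpha> x \<in> c))"
        using \<alpha>_neq[OF x] by (cases "x \<in> c"; cases "\<alpha> x \<in> c") (auto simp: Int_insert_right)
      moreover have "odd (card (c \<inter> darts_of X)) \<longleftrightarrow> c = orb \<phi> x"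
        using X(2) c unfolding real_def by blast
      ultimately show ?thesis
        unfolding odd_darts_of_sdiff darts_of_edge[OF x] mem by argo
    qed
    then have "real (sdiff X {orb \<alpha> x}) (orb \<phi> (\<alpha> x))" unfolding real_def by blast
    moreover have "sdiff X {orb \<alpha> x} \<subseteq> edges D \<alpha>" using X(1) x by (auto simp: edges_def)
    ultimately show ?thesis by blast
  qed
  have single: "\<exists>X \<subseteq> edges D \<alpha>. real X (orb \<phi> d)" if d: "d \<in> D" for d
  proof (rule conn_induct[OF d0 d, where P = "\<lambda>d. \<exists>X \<subseteq> edges D \<alpha>. real X (orb \<phi> d)"])
    \<comment> \<open>The parity of the base cell is left free, so here no cell has to be odd and
      the empty set serves.\<close>
    show "\<exists>X \<subseteq> edges D \<alpha>. real X (orb \<phi> d0)"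
      by (rule exI[of _ "{}"]) (auto simp: darts_of_def real_def)
  next
    fix x assume x: "x \<in> D" and IH: "\<exists>X \<subseteq> edges D \<alpha>. real X (orb \<phi> x)"
    show "\<exists>X \<subseteq> edges D \<alpha>. real X (orb \<phi> (\<alpha> x))"
      by (rule step[OF x IH])
    \<comment> \<open>\<open>\<sigma> x\<close> lies on the same cell as \<open>\<alpha> x\<close>,
      so rotation needs no second construction.\<close>
    have "orb \<phi> (\<sigma> x) = orb \<phi> (\<alpha> x)"
      using orb_\<phi>_step[of "\<alpha> x"] x by (simp add: \<phi>\<alpha>)
    then show "\<exists>X \<subseteq> edges D \<alpha>. real X (orb \<phi> (\<sigma> x))"
      using step[OF x IH] by simp
  qed
  have "finite Y" using Y fin by (auto simp: cells_def intro: finite_subset)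
  then show ?thesis using Y
  proof (induction Y)
    case empty
    then show ?case by (intro exI[of _ "{}"]) (auto simp: darts_of_def)
  next
    case (insert y Y)
    obtain X where X: "X \<subseteq> edges D \<alpha>" "\<forall>c \<in> ?F. odd (card (c \<inter> darts_of X)) \<longleftrightarrow> c \<in> Y"
      using insert by auto
    obtain d where d: "d \<in> D" "y = orb \<phi> d" using insert.prems by (auto simp: cells_def)
    obtain X' where X': "X' \<subseteq> edges D \<alpha>" "real X' y"
      using single[OF d(1)] d(2) by blast
    have "\<forall>c \<in> ?F. odd (card (c \<inter> darts_of (sdiff X X'))) \<longleftrightarrow> c \<in> insert y Y"
      unfolding odd_darts_of_sdiff using X(2) X'(2) unfolding real_def by simp (use insert.hyps(2) in blast)
    moreover have "sdiff X X' \<subseteq> edges D \<alpha>" using X(1) X'(1) by blast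
    ultimately show ?case by blast
  qed
qed

text \<open>Realising all parity patterns bounds the number of cocycles by
  \<open>2 ^ card ?V\<close>, and injectivity of \<open>coboundary\<close> provides that many
  coboundaries, so the two sets coincide.\<close>

lemma cocycle_is_coboundary:
  assumes "d0 \<in> D" "X \<in> cocycles"
  shows "\<exists>W. X = coboundary W"
proof -
  let ?V = "verts D \<sigma> - {orb \<sigma> d0}" and ?F = "cells D \<alpha> \<sigma> - {orb \<phi> d0}" and ?E = "edges D \<alpha>"
  have finE: "finite ?E" and finV: "finite (verts D \<sigma>)" and finF: "finite (cells D \<alpha> \<sigma>)"
    using fin by (auto simp: edges_def verts_def cells_def)
  have in_V: "orb \<sigma> d0 \<in> verts D \<sigma>" and in_F: "orb \<phi> d0 \<in> cells D \<alpha> \<sigma>"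
    using assms(1) by (auto simp: verts_def cells_def)
  have "card (verts D \<sigma>) > 0" "card (cells D \<alpha> \<sigma>) > 0"
    using in_V in_F finV finF by (auto simp: card_gt_0_iff)
  \<comment> \<open>The deleted base vertex and base cell absorb the 2 in Euler's formula.\<close>
  then have E: "card ?E = card ?V + card ?F"
    using euler in_V in_F by (simp add: card_Diff_singleton)
  have "\<exists>g. \<forall>Y \<in> Pow ?F. g Y \<subseteq> ?E \<and> (\<forall>c\<in>?F. odd (card (c \<inter> darts_of (g Y))) \<longleftrightarrow> c \<in> Y)"
    by (rule bchoice, intro ballI) (use ex_parity[OF assms(1)] in simp)
  then obtain g where "\<forall>Y \<in> Pow ?F. g Y \<subseteq> ?E \<and> (\<forall>c\<in>?F. odd (card (c \<inter> darts_of (g Y))) \<longleftrightarrow> c \<in> Y)" ..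
  then have g: "g Y \<subseteq> ?E" "c \<in> ?F \<Longrightarrow> odd (card (c \<inter> darts_of (g Y))) \<longleftrightarrow> c \<in> Y" if "Y \<subseteq> ?F" for Y c
    using that by simp_all
  \<comment> \<open>\<open>g Y\<close> is a chosen edge set with parity pattern \<open>Y\<close>.
    Cocycles are even on every cell, so the sum still displays \<open>Y\<close>, and adding
    \<open>g Y\<close> again recovers \<open>X\<close>.\<close>
  let ?f = "\<lambda>(X, Y). sdiff X (g Y)"
  have "inj_on ?f (cocycles \<times> Pow ?F)"
  proof (rule inj_onI, clarify)
    fix X Y X' Y' assume X: "X \<in> cocycles" "X' \<in> cocycles" and Y: "Y \<subseteq> ?F" "Y' \<subseteq> ?F"
      and eq: "sdiff X (g Y) = sdiff X' (g Y')"
    have "c \<in> Y \<longleftrightarrow> c \<in> Y'" if "c \<in> ?F" for c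
    proof -
      have "even (card (c \<inter> darts_of X))" "even (card (c \<inter> darts_of X'))"
        using X that by (auto simp: cocycles_def)
      then have "odd (card (c \<inter> darts_of (sdiff X (g Y)))) \<longleftrightarrow> c \<in> Y"
        "odd (card (c \<inter> darts_of (sdiff X' (g Y')))) \<longleftrightarrow> c \<in> Y'"
        unfolding odd_darts_of_sdiff using g(2)[OF Y(1) that] g(2)[OF Y(2) that] by simp_all
      then show ?thesis using eq by simp
    qed
    then have "Y = Y'" using Y by blast
    then show "X = X' \<and> Y = Y'" using eq by blast
  qed
  moreover have "?f ` (cocycles \<times> Pow ?F) \<subseteq> Pow ?E"
  proof clarify
    fix X Y x assume X: "X \<in> cocycles" and Y: "Y \<subseteq> ?F" and x: "x \<in> sdiff X (g Y)"
    have "X \<subseteq> ?E" using X by (simp add: cocycles_def)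
    then show "x \<in> ?E" using x g(1)[OF Y] by blast
  qed
  ultimately have "card (cocycles \<times> Pow ?F) \<le> card (Pow ?E)"
    using finE by (intro card_inj_on_le) auto
  then have "card cocycles * 2 ^ card ?F \<le> 2 ^ card ?V * 2 ^ card ?F"
    using finE finF by (simp add: card_cartesian_product card_Pow E power_add)
  then have "card cocycles \<le> 2 ^ card ?V" by simp
  moreover have "card (coboundary ` Pow ?V) = 2 ^ card ?V"
    using coboundary_inj[OF assms(1)] finV by (simp add: card_image card_Pow)
  moreover have "finite cocycles"
    using finE by (auto simp: cocycles_def intro: finite_subset[of _ "Pow ?E"])
  moreover have "coboundary ` Pow ?V \<subseteq> cocycles" using coboundary_cocycle by auto
  ultimately have "coboundary ` Pow ?V = cocycles" by (intro card_seteq) auto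
  then show ?thesis using assms(2) by blast
qed

text \<open>\<open>U\<close> is the dart set of a set of edges. That set is a cocycle, hence the cut
  of some \<open>W\<close>, and membership in \<open>W\<close> is the potential up to
  complement.\<close>

lemma ex_potential:
  assumes "d0 \<in> D" "U \<subseteq> D" "\<And>d. d \<in> U \<Longrightarrow> \<alpha> d \<in> U"
    and "\<And>c. c \<in> cells D \<alpha> \<sigma> \<Longrightarrow> even (card (c \<inter> U))"
  shows "\<exists>h. \<not> h d0 \<and> (\<forall>d\<in>D. h (\<sigma> d) = h d) \<and> (\<forall>d\<in>D. h (\<alpha> d) \<noteq> h d \<longleftrightarrow> d \<in> U)"
proof -
  have U: "darts_of (orb \<alpha> ` U) = U"
  proof
    show "U \<subseteq> darts_of (orb \<alpha> ` U)" using assms(2) by (auto simp: darts_of_def)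
    show "darts_of (orb \<alpha> ` U) \<subseteq> U"
    proof
      fix d assume "d \<in> darts_of (orb \<alpha> ` U)"
      then obtain u where "d \<in> D" "u \<in> U" "orb \<alpha> u = orb \<alpha> d" by (auto simp: darts_of_def)
      then show "d \<in> U" using assms(2,3) orb_\<alpha>_eq_iff[of u d] by auto
    qed
  qed
  then have "orb \<alpha> ` U \<in> cocycles"
    using assms by (auto simp: cocycles_def edges_def)
  then obtain W where "orb \<alpha> ` U = coboundary W"
    using cocycle_is_coboundary assms(1) by blast
  then have "d \<in> U \<longleftrightarrow> (orb \<sigma> (\<alpha> d) \<in> W) \<noteq> (orb \<sigma> d \<in> W)" if "d \<in> D" for d
    using U darts_of_coboundary[of W] that by auto
  \<comment> \<open>Comparing with the vertex of \<open>d0\<close> passes to the complement of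
    \<open>W\<close> where necessary, so that \<open>h d0\<close> is false.\<close>
  then show ?thesis
    by (intro exI[of _ "\<lambda>d. (orb \<sigma> d \<in> W) \<noteq> (orb \<sigma> d0 \<in> W)"]) (auto simp: orb_\<sigma>_step)
qed

end

section \<open>Strands\<close>

locale one_system = sphere +
  fixes B1 B2 :: "'a set"
  assumes one_system: "k_system_annular_diagram 1 D \<alpha> \<sigma> B1 B2"
begin

abbreviation sqs :: "'a set set" where "sqs \<equiv> squares D \<alpha> \<sigma> B1 B2"

definition SQ :: "'a set" where
  "SQ = {d \<in> D. orb \<phi> d \<in> sqs}"

lemma diagram: "square_annular_diagram D \<alpha> \<sigma> B1 B2"
  using one_system unfolding k_system_annular_diagram_def by blast

lemma B1_cell: "B1 \<in> cells D \<alpha> \<sigma>" and B2_cell: "B2 \<in> cells D \<alpha> \<sigma>"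
  and B1_neq_B2: "B1 \<noteq> B2" and card_square: "s \<in> sqs \<Longrightarrow> card s = 4"
  using diagram unfolding square_annular_diagram_def by blast+

lemma B1_in: "d \<in> B1 \<Longrightarrow> d \<in> D" and B2_in: "d \<in> B2 \<Longrightarrow> d \<in> D"
  using cell_subset B1_cell B2_cell by blast+

lemma SQ_in [simp]: "d \<in> SQ \<Longrightarrow> d \<in> D"
  by (simp add: SQ_def)

lemma SQ_iff: "d \<in> D \<Longrightarrow> d \<in> SQ \<longleftrightarrow> d \<notin> B1 \<and> d \<notin> B2"
proof -
  assume d: "d \<in> D"
  have "orb \<phi> d \<in> cells D \<alpha> \<sigma>" using d by (auto simp: cells_def)
  moreover have "orb \<phi> d = B1 \<longleftrightarrow> d \<in> B1" "orb \<phi> d = B2 \<longleftrightarrow> d \<in> B2"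
    using cell_orb[OF B1_cell, of d] cell_orb[OF B2_cell, of d] orb_self[of d \<phi>] by metis+
  ultimately show ?thesis using d unfolding SQ_def squares_def by blast
qed

lemma B1_not_B2: "d \<in> B1 \<Longrightarrow> d \<notin> B2"
  using cell_disjoint[OF B1_cell B2_cell, of d] B1_neq_B2 by blast

lemma B1_not_SQ: "d \<in> B1 \<Longrightarrow> d \<notin> SQ" and B2_not_SQ: "d \<in> B2 \<Longrightarrow> d \<notin> SQ"
  by (auto simp: SQ_iff[OF B1_in] SQ_iff[OF B2_in])

lemma SQ_orb: "d \<in> SQ \<Longrightarrow> orb \<phi> d \<in> sqs"
  unfolding SQ_def by blast

lemma SQ_\<phi> [simp]: "d \<in> SQ \<Longrightarrow> \<phi> d \<in> SQ"
  unfolding SQ_def using orb_\<phi>_step by simp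

lemma square_cycle:
  assumes "d \<in> SQ"
  shows \<phi>4 [simp]: "\<phi> (\<phi> (\<phi> (\<phi> d))) = d"
    and orb_square: "orb \<phi> d = {d, \<phi> d, \<phi> (\<phi> d), \<phi> (\<phi> (\<phi> d))}"
    and "\<phi> d \<noteq> d" "\<phi> (\<phi> d) \<noteq> d" "\<phi> (\<phi> (\<phi> d)) \<noteq> d"
proof -
  have d: "d \<in> D" using assms by simp
  have c: "card (orb \<phi> d) = 4" using card_square SQ_orb[OF assms] by blast
  note cyc = orb_cycle[OF fin bij_\<phi> d, unfolded c]
  have 4: "{..<4::nat} = {0, 1, 2, 3}" by auto
  show "\<phi> (\<phi> (\<phi> (\<phi> d))) = d" using cyc(2) by (simp add: eval_nat_numeral)
  show "orb \<phi> d = {d, \<phi> d, \<phi> (\<phi> d), \<phi> (\<phi> (\<phi> d))}"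
    unfolding cyc(4) 4 by (simp add: eval_nat_numeral)
  have "(\<phi> ^^ i) d \<noteq> d" if "i \<noteq> 0" "i < 4" for i
    using inj_onD[OF cyc(3), of i 0] that by auto
  from this[of 1] this[of 2] this[of 3]
  show "\<phi> d \<noteq> d" "\<phi> (\<phi> d) \<noteq> d" "\<phi> (\<phi> (\<phi> d)) \<noteq> d"
    by (simp_all add: eval_nat_numeral)
qed

text \<open>Crosses the edge of \<open>d\<close> and the square behind it, arriving at the opposite edge of that square.\<close>
definition \<psi> :: "'a \<Rightarrow> 'a" where
  "\<psi> d = \<phi> (\<phi> (\<alpha> d))"

abbreviation st :: "'a \<Rightarrow> nat \<Rightarrow> 'a" where
  "st p i \<equiv> (\<psi> ^^ i) p"

lemma bij_\<psi>: "bij_betw \<psi> D D"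
proof -
  have "\<psi> = \<phi> \<circ> (\<phi> \<circ> \<alpha>)" by (auto simp: \<psi>_def)
  then show ?thesis
    using bij_betw_trans[OF bij_betw_trans[OF bij_\<alpha> bij_\<phi>] bij_\<phi>] by simp
qed

lemma st_in [simp]: "p \<in> D \<Longrightarrow> st p i \<in> D"
  by (rule funpow_in[OF bij_\<psi>])

lemma \<psi>_inj: "d \<in> D \<Longrightarrow> e \<in> D \<Longrightarrow> \<psi> d = \<psi> e \<Longrightarrow> d = e"
  using bij_\<psi> unfolding bij_betw_def by (meson inj_onD)

text \<open>\<open>\<psi>\<close> permutes all darts, but it follows a dual curve only as long as
  the cell behind the current edge is a square.\<close>

definition chain :: "'a \<Rightarrow> nat \<Rightarrow> bool" where
  "chain p i \<longleftrightarrow> (\<forall>l<i. \<alpha> (st p l) \<in> SQ)"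

lemma st_Suc: "st p (Suc i) = \<phi> (\<phi> (\<alpha> (st p i)))"
  by (simp add: \<psi>_def)

lemma chain_SQ: "chain p i \<Longrightarrow> 0 < i \<Longrightarrow> st p i \<in> SQ"
proof (cases i)
  case (Suc j)
  assume "chain p i"
  then have "\<alpha> (st p j) \<in> SQ" unfolding chain_def Suc by blast
  then show ?thesis unfolding Suc st_Suc by (intro SQ_\<phi>)
qed simp

lemma chain_mono: "chain p i \<Longrightarrow> j \<le> i \<Longrightarrow> chain p j"
  by (simp add: chain_def)

text \<open>\<open>\<psi>\<close> is injective, so both strands can be traced back step by step.
  Their later darts lie in \<open>SQ\<close> and their starts do not, so both run out at the same
  moment.\<close>

lemma chain_unique:
  assumes "p \<in> D" "p \<notin> SQ" "q \<in> D" "q \<notin> SQ" "chain p i" "chain q j" "st p i = st q j"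
  shows "p = q \<and> i = j"
  using assms(5-7)
proof (induction i arbitrary: j)
  case 0
  then have "j = 0" using chain_SQ[of q j] assms(2) by (cases j) auto
  then show ?case using 0 by simp
next
  case (Suc i)
  then obtain j' where j: "j = Suc j'"
    using chain_SQ[of p "Suc i"] assms(4) by (cases j) auto
  have "\<psi> (st p i) = \<psi> (st q j')"
    using Suc.prems(3) by (simp add: j)
  then have "st p i = st q j'"
    by (rule \<psi>_inj[OF st_in[OF assms(1)] st_in[OF assms(3)]])
  moreover have "chain p i" "chain q j'"
    using Suc.prems(1,2) unfolding j by (auto elim: chain_mono)
  ultimately show ?case using Suc.IH[of j'] j by simp
qed

section \<open>Length and end of a strand\<close>

definition len :: "'a \<Rightarrow> nat" where
  "len p = (LEAST m. \<alpha> (st p m) \<notin> SQ)"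

text \<open>A strand that never left the squares would visit infinitely many distinct darts.\<close>

lemma ex_strand_end:
  assumes "p \<in> B1" shows "\<exists>m. \<alpha> (st p m) \<notin> SQ"
proof (rule ccontr)
  assume "\<not> ?thesis"
  then have "chain p i" for i by (simp add: chain_def)
  then have "inj (\<lambda>i. st p i)"
    using chain_unique[OF B1_in[OF assms] B1_not_SQ[OF assms] B1_in[OF assms] B1_not_SQ[OF assms]]
    by (intro injI) blast
  moreover have "finite (range (\<lambda>i. st p i))"
    using fin st_in[OF B1_in[OF assms]] by (auto intro: finite_subset)
  ultimately show False using finite_imageD by blast
qed

lemma len_end: "p \<in> B1 \<Longrightarrow> \<alpha> (st p (len p)) \<notin> SQ"
  unfolding len_def by (rule LeastI_ex[OF ex_strand_end])

lemma len_SQ: "l < len p \<Longrightarrow> \<alpha> (st p l) \<in> SQ"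
  unfolding len_def using not_less_Least by blast

lemma len_chain: "i \<le> len p \<Longrightarrow> chain p i"
  using len_SQ by (simp add: chain_def)

lemma st_SQ: "i \<le> len p \<Longrightarrow> 0 < i \<Longrightarrow> st p i \<in> SQ"
  using chain_SQ len_chain by blast

lemma st_cell: "i < len p \<Longrightarrow> orb \<phi> (st p (Suc i)) = orb \<phi> (\<alpha> (st p i))"
  using len_SQ[of i p] by (simp add: \<psi>_def orb_\<phi>_step)

lemma st_inj:
  assumes "p \<in> B1" "q \<in> B1" "i \<le> len p" "j \<le> len q" "st p i = st q j"
  shows "p = q \<and> i = j"
  using chain_unique[OF B1_in[OF assms(1)] B1_not_SQ[OF assms(1)] B1_in[OF assms(2)] B1_not_SQ[OF assms(2)]]
    len_chain assms(3-5) by blast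

lemma SQ_\<phi>\<phi>_cancel: "d \<in> D \<Longrightarrow> \<alpha> d \<in> SQ \<Longrightarrow> \<phi> (\<phi> (\<psi> d)) = \<alpha> d"
  by (simp add: \<psi>_def)

text \<open>As the reversed strand starts on \<open>B2\<close>, strands from \<open>B1\<close> never traverse an edge in both directions.\<close>
lemma st_reverse:
  assumes "p \<in> B1" "t \<le> len p"
  shows "st (\<alpha> (st p (len p))) t = \<alpha> (st p (len p - t))"
  using assms(2)
proof (induction t)
  case (Suc t)
  let ?i = "len p - Suc t"
  have i: "len p - t = Suc ?i" using Suc.prems by simp
  have "st (\<alpha> (st p (len p))) (Suc t) = \<psi> (\<alpha> (st p (Suc ?i)))"
    using Suc i by simp
  also have "\<dots> = \<phi> (\<phi> (st p (Suc ?i)))"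
    using B1_in[OF assms(1)] by (simp add: \<psi>_def)
  also have "\<dots> = \<alpha> (st p ?i)"
    using SQ_\<phi>\<phi>_cancel[of "st p ?i"] len_SQ[of ?i p] B1_in[OF assms(1)] Suc.prems by simp
  finally show ?case .
qed simp

text \<open>The square of \<open>d\<close> is either ahead of edge number \<open>i\<close> or behind
  it; crossing it leads to edge number \<open>i + 1\<close> or \<open>i - 1\<close> of the
  strand.\<close>

lemma \<alpha>_SQ_cases:
  assumes "p \<in> B1" "i \<le> len p" "d \<in> SQ" "d = st p i \<or> d = \<alpha> (st p i)"
  obtains (fwd) "i < len p" "d = \<alpha> (st p i)" "\<phi> (\<phi> d) = st p (Suc i)"
  | (bwd) j where "i = Suc j" "d = st p i" "\<phi> (\<phi> d) = \<alpha> (st p j)"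
  using assms(4)
proof
  assume d: "d = st p i"
  then obtain j where j: "i = Suc j" using assms(1,3) B1_not_SQ by (cases i) auto
  then have "\<phi> (\<phi> d) = \<alpha> (st p j)"
    using SQ_\<phi>\<phi>_cancel[of "st p j"] len_SQ[of j p] B1_in[OF assms(1)] assms(2) d by simp
  then show ?thesis using bwd j d by blast
next
  assume d: "d = \<alpha> (st p i)"
  have "i < len p" using assms len_end[OF assms(1)] d by (metis le_neq_implies_less)
  then show ?thesis using fwd d by (simp add: \<psi>_def)
qed

section \<open>Strands and dual curves\<close>

abbreviation adj :: "'a set \<Rightarrow> 'a set \<Rightarrow> bool" where
  "adj \<equiv> U_adj D \<alpha> \<sigma> B1 B2"

lemma midcube: "d \<in> SQ \<Longrightarrow> {d, \<phi> (\<phi> d)} \<in> midcubes D \<alpha> \<sigma> B1 B2"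
  unfolding midcubes_def SQ_def by (auto simp: eval_nat_numeral)

lemma midcubeE:
  assumes "m \<in> midcubes D \<alpha> \<sigma> B1 B2"
  obtains d where "d \<in> SQ" "m = {d, \<phi> (\<phi> d)}"
  using assms unfolding midcubes_def SQ_def by (auto simp: eval_nat_numeral)

lemma adjI: "d \<in> SQ \<Longrightarrow> adj (orb \<alpha> d) (orb \<alpha> (\<phi> (\<phi> d)))"
  unfolding U_adj_def mc_at_def by (rule bexI[OF _ midcube]) auto

lemma adjE:
  assumes "adj e e'"
  obtains d where "d \<in> SQ" "e = orb \<alpha> d" "e' = orb \<alpha> d \<or> e' = orb \<alpha> (\<phi> (\<phi> d))"
proof -
  obtain m where m: "m \<in> midcubes D \<alpha> \<sigma> B1 B2" "mc_at \<alpha> m e" "mc_at \<alpha> m e'"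
    using assms by (auto simp: U_adj_def)
  obtain d where d: "d \<in> SQ" "m = {d, \<phi> (\<phi> d)}" using midcubeE[OF m(1)] .
  have e: "e = orb \<alpha> d \<or> e = orb \<alpha> (\<phi> (\<phi> d))" "e' = orb \<alpha> d \<or> e' = orb \<alpha> (\<phi> (\<phi> d))"
    using m(2,3) unfolding mc_at_def d(2) by blast+
  from e(1) show ?thesis
  proof
    assume "e = orb \<alpha> (\<phi> (\<phi> d))"
    then show ?thesis using that[of "\<phi> (\<phi> d)"] e(2) d(1) by auto
  qed (use that d e in blast)
qed

lemma adj_sym: "adj e e' \<Longrightarrow> adj e' e"
  by (auto simp: U_adj_def)

lemma adjs_sym: "adj\<^sup>*\<^sup>* e e' \<Longrightarrow> adj\<^sup>*\<^sup>* e' e"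
  using adj_sym by (metis sympD sympI symp_rtranclp)

definition curve :: "'a \<Rightarrow> 'a set set" where
  "curve d = {e \<in> edges D \<alpha>. adj\<^sup>*\<^sup>* (orb \<alpha> d) e}"

lemma curve_dual: "d \<in> D \<Longrightarrow> curve d \<in> dual_curves D \<alpha> \<sigma> B1 B2"
  unfolding dual_curves_def curve_def edges_def by blast

lemma curve_self: "d \<in> D \<Longrightarrow> orb \<alpha> d \<in> curve d"
  unfolding curve_def edges_def by blast

lemma curve_eq: "adj\<^sup>*\<^sup>* (orb \<alpha> d) (orb \<alpha> e) \<Longrightarrow> curve d = curve e"
  unfolding curve_def by (auto intro: rtranclp_trans adjs_sym)

lemma joins:
  assumes "d \<in> D"
  shows "\<exists>b\<in>B1. adj\<^sup>*\<^sup>* (orb \<alpha> d) (orb \<alpha> b)" "\<exists>b\<in>B2. adj\<^sup>*\<^sup>* (orb \<alpha> d) (orb \<alpha> b)"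
proof -
  have "joins_boundaries D \<alpha> \<sigma> B1 B2 (curve d)"
    using one_system curve_dual[OF assms] unfolding k_system_annular_diagram_def by blast
  then obtain e1 e2 where "arc_ends D \<alpha> \<sigma> B1 B2 (curve d) = {e1, e2}"
    "e1 \<in> bd_edges \<alpha> B1" "e2 \<in> bd_edges \<alpha> B2"
    unfolding joins_boundaries_def by blast
  moreover from this(1) have "e1 \<in> curve d" "e2 \<in> curve d"
    unfolding arc_ends_def by blast+
  ultimately show "\<exists>b\<in>B1. adj\<^sup>*\<^sup>* (orb \<alpha> d) (orb \<alpha> b)" "\<exists>b\<in>B2. adj\<^sup>*\<^sup>* (orb \<alpha> d) (orb \<alpha> b)"
    unfolding bd_edges_def curve_def by blast+
qed

lemma adj_st: "i < len p \<Longrightarrow> p \<in> B1 \<Longrightarrow> adj (orb \<alpha> (st p i)) (orb \<alpha> (st p (Suc i)))"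
proof -
  assume i: "i < len p" and p: "p \<in> B1"
  have "orb \<alpha> (\<alpha> (st p i)) = orb \<alpha> (st p i)"
    using orb_\<alpha>_eq_iff[of "\<alpha> (st p i)" "st p i"] B1_in[OF p] by simp
  then show ?thesis
    using adjI[OF len_SQ[OF i]] by (simp add: st_Suc del: funpow.simps)
qed

lemma adjs_st: "p \<in> B1 \<Longrightarrow> i \<le> len p \<Longrightarrow> adj\<^sup>*\<^sup>* (orb \<alpha> p) (orb \<alpha> (st p i))"
proof (induction i)
  case (Suc i)
  then show ?case
    using adj_st[of i p] by (simp add: rtranclp.rtrancl_into_rtrancl del: funpow.simps)
qed simp

text \<open>By \<open>\<alpha>_SQ_cases\<close> a midcube at an edge of the strand leads to the next
  or the previous edge. The strand therefore exhausts its component of the glued midcubes.\<close>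

lemma strand_closed:
  assumes p: "p \<in> B1" and "adj\<^sup>*\<^sup>* (orb \<alpha> p) e"
  shows "\<exists>i\<le>len p. e = orb \<alpha> (st p i)"
  using assms(2)
proof (induction rule: rtranclp_induct)
  case base
  then show ?case by (intro exI[of _ 0]) simp
next
  case (step e e')
  obtain i where i: "i \<le> len p" "e = orb \<alpha> (st p i)" using step.IH by blast
  obtain d where d: "d \<in> SQ" "e = orb \<alpha> d" "e' = orb \<alpha> d \<or> e' = orb \<alpha> (\<phi> (\<phi> d))"
    using adjE[OF step.hyps(2)] .
  have "d = st p i \<or> d = \<alpha> (st p i)"
    using orb_\<alpha>_eq_iff[of "st p i" d] B1_in[OF p] d i by auto
  from p i(1) d(1) this show ?case
  proof (cases rule: \<alpha>_SQ_cases)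
    case fwd
    then show ?thesis using d(2,3) i by (metis Suc_leI)
  next
    case (bwd j)
    have "orb \<alpha> (\<alpha> (st p j)) = orb \<alpha> (st p j)"
      using orb_\<alpha>_eq_iff[of "\<alpha> (st p j)" "st p j"] B1_in[OF p] by simp
    moreover have "j \<le> len p" using bwd i by simp
    ultimately show ?thesis using d(2,3) i bwd(3) by metis
  qed
qed

text \<open>The dual curve reaches \<open>B2\<close> in a dart \<open>b\<close>, which lies on an
  edge of the strand. The strand's own darts are in \<open>B1\<close> or in squares, so
  \<open>b\<close> is a reversed one, and only the last of these faces no square.\<close>

lemma strand_end_B2:
  assumes p: "p \<in> B1" shows "\<alpha> (st p (len p)) \<in> B2"
proof -
  obtain b where b: "b \<in> B2" "adj\<^sup>*\<^sup>* (orb \<alpha> p) (orb \<alpha> b)" using joins(2)[OF B1_in[OF p]] by blast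
  obtain i where i: "i \<le> len p" "orb \<alpha> (st p i) = orb \<alpha> b" using strand_closed[OF p b(2)] by metis
  have "b = st p i \<or> b = \<alpha> (st p i)"
    using orb_\<alpha>_eq_iff[of "st p i" b] B1_in[OF p] B2_in[OF b(1)] i by auto
  moreover have "b \<noteq> st p i"
    using st_SQ[OF i(1)] B2_not_SQ[OF b(1)] B1_not_B2[OF p] b(1) by (cases i) auto
  moreover have "i = len p" if "b = \<alpha> (st p i)"
    using len_SQ[of i p] i(1) B2_not_SQ[OF b(1)] that by (metis le_neq_implies_less)
  ultimately show ?thesis using b(1) by blast
qed

text \<open>Every dual curve meets \<open>B1\<close>, and the strand from there exhausts it.\<close>

lemma strand_cover:
  assumes d: "d \<in> D"
  obtains p i where "p \<in> B1" "i \<le> len p" "d = st p i \<or> d = \<alpha> (st p i)"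
proof -
  obtain p where p: "p \<in> B1" "adj\<^sup>*\<^sup>* (orb \<alpha> d) (orb \<alpha> p)" using joins(1)[OF d] by blast
  obtain i where i: "i \<le> len p" "orb \<alpha> (st p i) = orb \<alpha> d"
    using strand_closed[OF p(1) adjs_sym[OF p(2)]] by metis
  then have "d = st p i \<or> d = \<alpha> (st p i)"
    using orb_\<alpha>_eq_iff[of "st p i" d] B1_in[OF p(1)] d by auto
  then show ?thesis using that p i by blast
qed

text \<open>Otherwise the reversed strand of \<open>q\<close>, which starts in \<open>B2\<close>,
  would share a dart with the strand of \<open>p\<close>, and tracing both back gives a dart on both
  boundary paths.\<close>

lemma st_neq_\<alpha>_st:
  assumes "p \<in> B1" "q \<in> B1" "i \<le> len p" "j \<le> len q"
  shows "st p i \<noteq> \<alpha> (st q j)"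
proof
  let ?q = "\<alpha> (st q (len q))"
  assume eq: "st p i = \<alpha> (st q j)"
  have q: "?q \<in> B2" by (rule strand_end_B2[OF assms(2)])
  have "chain ?q (len q - j)"
    unfolding chain_def
  proof (intro allI impI)
    fix l assume l: "l < len q - j"
    then have "\<alpha> (st ?q l) = st q (len q - l)"
      using st_reverse[OF assms(2), of l] B1_in[OF assms(2)] by simp
    then show "\<alpha> (st ?q l) \<in> SQ" using st_SQ[of "len q - l" q] l by simp
  qed
  moreover have "st p i = st ?q (len q - j)"
    using st_reverse[OF assms(2), of "len q - j"] eq assms(4) by simp
  ultimately have "p = ?q"
    using chain_unique[OF B1_in[OF assms(1)] B1_not_SQ[OF assms(1)] B2_in[OF q] B2_not_SQ[OF q] len_chain[OF assms(3)]]
    by blast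
  then show False using B1_not_B2[OF assms(1)] q by metis
qed

section \<open>Labelling darts by strands, and how strands cross\<close>

definition foot :: "'a \<Rightarrow> 'a" where
  "foot d = (THE p. p \<in> B1 \<and> (\<exists>i\<le>len p. d = st p i \<or> d = \<alpha> (st p i)))"

lemma \<alpha>_inj: "d \<in> D \<Longrightarrow> e \<in> D \<Longrightarrow> \<alpha> d = \<alpha> e \<Longrightarrow> d = e"
  using \<alpha>\<alpha> by metis

text \<open>The description in \<open>foot\<close> is unique because no dart lies on two strands and
  no edge is traversed in both directions.\<close>

lemma foot_eqI:
  assumes "p \<in> B1" "i \<le> len p" "d = st p i \<or> d = \<alpha> (st p i)"
  shows "foot d = p"
  unfolding foot_def
proof (rule the_equality)
  show "p \<in> B1 \<and> (\<exists>i\<le>len p. d = st p i \<or> d = \<alpha> (st p i))" using assms by blast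
  fix q assume "q \<in> B1 \<and> (\<exists>i\<le>len q. d = st q i \<or> d = \<alpha> (st q i))"
  then obtain j where q: "q \<in> B1" "j \<le> len q" "d = st q j \<or> d = \<alpha> (st q j)" by blast
  have "st p i = st q j"
    using q(3) assms(3) st_neq_\<alpha>_st[OF assms(1) q(1) assms(2) q(2)] st_neq_\<alpha>_st[OF q(1) assms(1) q(2) assms(2)]
      \<alpha>_inj[OF st_in[OF B1_in[OF assms(1)]] st_in[OF B1_in[OF q(1)]]] by metis
  then show "q = p" using st_inj[OF assms(1) q(1) assms(2) q(2)] by simp
qed

lemma foot_st [simp]: "p \<in> B1 \<Longrightarrow> i \<le> len p \<Longrightarrow> foot (st p i) = p"
  and foot_\<alpha>_st [simp]: "p \<in> B1 \<Longrightarrow> i \<le> len p \<Longrightarrow> foot (\<alpha> (st p i)) = p"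
  by (auto intro: foot_eqI)

lemma foot_B1: "p \<in> B1 \<Longrightarrow> foot p = p"
  using foot_st[of p 0] by simp

lemma footE:
  assumes "d \<in> D"
  obtains i where "foot d \<in> B1" "i \<le> len (foot d)" "d = st (foot d) i \<or> d = \<alpha> (st (foot d) i)"
proof -
  obtain p i where p: "p \<in> B1" "i \<le> len p" "d = st p i \<or> d = \<alpha> (st p i)" using strand_cover[OF assms] .
  then show ?thesis using that[unfolded foot_eqI[OF p], OF p] by blast
qed

lemma foot_\<phi>\<phi> [simp]: "d \<in> SQ \<Longrightarrow> foot (\<phi> (\<phi> d)) = foot d"
proof -
  assume d: "d \<in> SQ"
  obtain p i where i: "p \<in> B1" "i \<le> len p" "d = st p i \<or> d = \<alpha> (st p i)"
    using strand_cover[OF SQ_in[OF d]] .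
  from i(1,2) d i(3) have "foot (\<phi> (\<phi> d)) = p"
  proof (cases rule: \<alpha>_SQ_cases)
    case fwd
    then show ?thesis using foot_st[OF i(1), of "Suc i"] by simp
  next
    case (bwd j)
    then show ?thesis using foot_\<alpha>_st[OF i(1), of j] i(2) by simp
  qed
  then show ?thesis using foot_eqI[OF i] by simp
qed

text \<open>Both edges are connected to the same start on \<open>B1\<close>. This carries the
  conditions on dual curves over to statements about \<open>foot\<close>.\<close>

lemma foot_curve:
  assumes "d \<in> D" "e \<in> D" "foot d = foot e"
  shows "curve d = curve e"
proof -
  have "curve d = curve (foot d)" if d: "d \<in> D" for d
  proof -
    obtain i where i: "foot d \<in> B1" "i \<le> len (foot d)" "d = st (foot d) i \<or> d = \<alpha> (st (foot d) i)"
      using footE[OF d] .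
    have "orb \<alpha> d = orb \<alpha> (st (foot d) i)"
      using orb_\<alpha>_eq_iff[OF st_in[OF B1_in[OF i(1)]] d] i(3) by metis
    then show ?thesis using curve_eq adjs_st[OF i(1,2)] by metis
  qed
  then show ?thesis using assms by metis
qed

lemma curve_mc: "d \<in> SQ \<Longrightarrow> {d, \<phi> (\<phi> d)} \<in> curve_mcs D \<alpha> \<sigma> B1 B2 (curve d)"
  unfolding curve_mcs_def mc_at_def using midcube[of d] curve_self[OF SQ_in, of d] by blast

lemma mc_in: "d \<in> SQ \<Longrightarrow> mc_in_square \<alpha> \<sigma> {d, \<phi> (\<phi> d)} (orb \<phi> d)"
  unfolding mc_in_square_def by blast

text \<open>Simplicity would identify the two midcubes of the square, although its four darts are
  distinct.\<close>

lemma curve_neq: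
  assumes d: "d \<in> SQ" shows "curve (\<phi> d) \<noteq> curve d"
proof
  assume eq: "curve (\<phi> d) = curve d"
  have "is_simple D \<alpha> \<sigma> B1 B2 (curve d)"
    using one_system curve_dual[OF SQ_in[OF d]] unfolding k_system_annular_diagram_def by blast
  moreover have "{\<phi> d, \<phi> (\<phi> (\<phi> d))} \<in> curve_mcs D \<alpha> \<sigma> B1 B2 (curve d)"
    using curve_mc[OF SQ_\<phi>[OF d]] eq by simp
  moreover have "mc_in_square \<alpha> \<sigma> {\<phi> d, \<phi> (\<phi> (\<phi> d))} (orb \<phi> d)"
    using mc_in[OF SQ_\<phi>[OF d]] d by (simp add: orb_\<phi>_step)
  ultimately have "{d, \<phi> (\<phi> d)} = {\<phi> d, \<phi> (\<phi> (\<phi> d))}"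
    using curve_mc[OF d] mc_in[OF d] unfolding is_simple_def by blast
  then have "\<phi> d = d \<or> \<phi> (\<phi> d) = \<phi> d" by (auto simp: doubleton_eq_iff)
  then show False using square_cycle(3)[OF d] square_cycle(3)[OF SQ_\<phi>[OF d]] by blast
qed

lemma foot_neq: "d \<in> SQ \<Longrightarrow> foot (\<phi> d) \<noteq> foot d"
  using curve_neq[of d] foot_curve[OF SQ_in[OF SQ_\<phi>] SQ_in, of d d] by blast

text \<open>Here the bound 1 enters: both squares belong to \<open>meet_squares\<close> of the same
  two curves.\<close>

lemma cross_once:
  assumes d: "d \<in> SQ" and e: "e \<in> SQ" and "foot d = foot e" "foot (\<phi> d) = foot (\<phi> e)"
  shows "orb \<phi> d = orb \<phi> e"
proof -
  let ?M = "meet_squares D \<alpha> \<sigma> B1 B2 (curve d) (curve (\<phi> d))"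
  have mem: "orb \<phi> x \<in> meet_squares D \<alpha> \<sigma> B1 B2 (curve x) (curve (\<phi> x))" if x: "x \<in> SQ" for x
  proof -
    have "mc_in_square \<alpha> \<sigma> {\<phi> x, \<phi> (\<phi> (\<phi> x))} (orb \<phi> x)"
      using mc_in[OF SQ_\<phi>[OF x]] x by (simp add: orb_\<phi>_step)
    then show ?thesis
      unfolding meet_squares_def
      using SQ_orb[OF x] curve_mc[OF x] mc_in[OF x] curve_mc[OF SQ_\<phi>[OF x]] by blast
  qed
  have "card ?M \<le> 1"
    using one_system curve_neq[OF d] curve_dual[OF SQ_in[OF d]] curve_dual[OF SQ_in[OF SQ_\<phi>[OF d]]]
    unfolding k_system_annular_diagram_def by blast
  moreover have "finite ?M"
    using fin by (auto simp: meet_squares_def squares_def cells_def)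
  moreover have "orb \<phi> e \<in> ?M"
    using mem[OF e] foot_curve[OF _ _ assms(3)] foot_curve[OF _ _ assms(4)] d e by simp
  ultimately show ?thesis using mem[OF d] card_le_Suc0_iff_eq[of ?M] by simp
qed

end

section \<open>Triangles at the boundary\<close>

context one_system
begin

text \<open>The first square on the strand of \<open>y\<close> is crossed by the strand of \<open>x\<close> after its edge number \<open>k\<close>.\<close>
definition triangle :: "'a \<Rightarrow> nat \<Rightarrow> 'a \<Rightarrow> bool" where
  "triangle x k y \<longleftrightarrow> x \<in> B1 \<and> y \<in> B1 \<and> k < len x \<and> 0 < len y \<and>
     (\<alpha> (st x k) = \<phi> (\<alpha> y) \<or> \<alpha> y = \<phi> (\<alpha> (st x k)))"

text \<open>The darts of the edges dual to the two sides of the triangle.\<close>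
definition sides :: "'a \<Rightarrow> nat \<Rightarrow> 'a \<Rightarrow> 'a set" where
  "sides x k y = {d. \<exists>i\<le>k. d = st x i \<or> d = \<alpha> (st x i)} \<union> {y, \<alpha> y}"

lemma \<alpha>_B1_SQ: "0 < len y \<Longrightarrow> \<alpha> y \<in> SQ"
  using len_SQ[of 0 y] by simp

lemma foot_\<alpha>_B1: "y \<in> B1 \<Longrightarrow> foot (\<alpha> y) = y"
  using foot_\<alpha>_st[of y 0] by simp

text \<open>Some strand contains the edge after \<open>\<alpha> y\<close> in the first square of
  \<open>y\<close>. It crosses that square in one of two directions, which are the two alternatives
  in \<open>triangle\<close>.\<close>

lemma ex_triangle:
  assumes y: "y \<in> B1" "0 < len y"
  shows "\<exists>x k. triangle x k y"
proof -
  have SQ: "\<alpha> y \<in> SQ" "\<phi> (\<alpha> y) \<in> SQ" using \<alpha>_B1_SQ[OF y(2)] by simp_all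
  obtain p i where p: "p \<in> B1" "i \<le> len p" "\<phi> (\<alpha> y) = st p i \<or> \<phi> (\<alpha> y) = \<alpha> (st p i)"
    using strand_cover[OF SQ_in[OF SQ(2)]] .
  from p(1,2) SQ(2) p(3) show ?thesis
  proof (cases rule: \<alpha>_SQ_cases)
    case fwd
    then have "triangle p i y" using p y unfolding triangle_def by simp
    then show ?thesis by blast
  next
    case (bwd j)
    have "\<phi> (\<alpha> (st p j)) = \<alpha> y"
      unfolding bwd(3)[symmetric] using SQ(1) by simp
    then have "triangle p j y" using p y bwd(1) unfolding triangle_def by simp
    then show ?thesis by blast
  qed
qed

text \<open>By \<open>cross_once\<close> both crossings happen in one square. Of its darts, the two
  next to \<open>?a\<close> belong to another strand and the opposite one is traversed the other
  way, which leaves only \<open>?a\<close> itself.\<close>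

lemma cross_unique:
  assumes z: "z \<in> B1" and i: "i < len z" and j: "j < len z"
    and eq: "foot (\<phi> (\<alpha> (st z i))) = foot (\<phi> (\<alpha> (st z j)))"
  shows "i = j"
proof -
  let ?a = "\<alpha> (st z i)" and ?b = "\<alpha> (st z j)"
  have SQ: "?a \<in> SQ" "?b \<in> SQ" using len_SQ i j by blast+
  have feet: "foot ?a = z" "foot ?b = z" using z i j by simp_all
  have "orb \<phi> ?b = orb \<phi> ?a" using cross_once[OF SQ(2,1)] feet eq by simp
  then have "?b \<in> {?a, \<phi> ?a, \<phi> (\<phi> ?a), \<phi> (\<phi> (\<phi> ?a))}"
    using orb_self[of ?b \<phi>] orb_square[OF SQ(1)] by blast
  moreover have "?b \<noteq> \<phi> ?a" using foot_neq[OF SQ(1)] feet by metis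
  moreover have "?b \<noteq> \<phi> (\<phi> (\<phi> ?a))"
    using foot_neq[OF SQ(1)] foot_\<phi>\<phi>[OF SQ_\<phi>[OF SQ(1)]] feet by metis
  moreover have "?b \<noteq> \<phi> (\<phi> ?a)"
    using st_neq_\<alpha>_st[OF z z, of "Suc i" j] i j by (simp add: \<psi>_def)
  ultimately have "?b = ?a" by blast
  then have "st z j = st z i"
    by (rule \<alpha>_inj[OF st_in[OF B1_in[OF z]] st_in[OF B1_in[OF z]]])
  then show ?thesis using st_inj[OF z z, of j i] i j by simp
qed

lemma cell_mem_iff: "c \<in> cells D \<alpha> \<sigma> \<Longrightarrow> d \<in> c \<longleftrightarrow> orb \<phi> d = c"
  using cell_orb orb_self by metis

text \<open>In a square crossed on the way, the contributions of the entry edge and the exit edge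
  cancel; only the first and the last cell of the dual path remain.\<close>

lemma odd_path:
  assumes x: "x \<in> B1" and c: "c \<in> cells D \<alpha> \<sigma>" and "k \<le> len x"
  shows "odd (card (c \<inter> {d. \<exists>i\<le>k. d = st x i \<or> d = \<alpha> (st x i)})) \<longleftrightarrow>
           (x \<in> c) \<noteq> (\<alpha> (st x k) \<in> c)"
  using assms(3)
proof (induction k)
  case 0
  have "{d. \<exists>i\<le>0. d = st x i \<or> d = \<alpha> (st x i)} = {x, \<alpha> x}" by auto
  then show ?case using odd_card_Int_pair[of x "\<alpha> x" c] \<alpha>_neq[OF B1_in[OF x]] by simp
next
  case (Suc k)
  let ?P = "\<lambda>k. {d. \<exists>i\<le>k. d = st x i \<or> d = \<alpha> (st x i)}"
  let ?a = "st x (Suc k)"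
  have a: "?a \<in> D" using B1_in[OF x] by (rule st_in)
  have P: "?P (Suc k) = ?P k \<union> {?a, \<alpha> ?a}"
    by (auto simp: le_Suc_eq simp del: funpow.simps)
  have "d \<notin> {?a, \<alpha> ?a}" if d: "d \<in> ?P k" for d
  proof -
    obtain i where i: "i \<le> k" "d = st x i \<or> d = \<alpha> (st x i)"
      using d unfolding mem_Collect_eq by (elim exE conjE)
    have "i \<le> len x" using i(1) Suc.prems by simp
    then have "st x i \<noteq> ?a" using st_inj[OF x x _ Suc.prems, of i] i(1) by (metis Suc_n_not_le_n)
    moreover from this have "\<alpha> (st x i) \<noteq> \<alpha> ?a" using \<alpha>_inj[OF st_in[OF B1_in[OF x]] a] by metis
    moreover have "st x i \<noteq> \<alpha> ?a" "?a \<noteq> \<alpha> (st x i)"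
      using st_neq_\<alpha>_st[OF x x \<open>i \<le> len x\<close> Suc.prems] st_neq_\<alpha>_st[OF x x Suc.prems \<open>i \<le> len x\<close>] .
    ultimately show ?thesis using i(2) by (metis insertE singletonD)
  qed
  then have disj: "(c \<inter> ?P k) \<inter> (c \<inter> {?a, \<alpha> ?a}) = {}" by blast
  have fin_c: "finite c" using cell_subset[OF c] fin by (rule finite_subset)
  have "c \<inter> ?P (Suc k) = (c \<inter> ?P k) \<union> (c \<inter> {?a, \<alpha> ?a})" unfolding P by blast
  then have "card (c \<inter> ?P (Suc k)) = card (c \<inter> ?P k) + card (c \<inter> {?a, \<alpha> ?a})"
    using card_Un_disjoint[OF _ _ disj] fin_c by simp
  then have "odd (card (c \<inter> ?P (Suc k))) \<longleftrightarrow> odd (card (c \<inter> ?P k)) \<noteq> odd (card (c \<inter> {?a, \<alpha> ?a}))"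
    by (simp only: odd_add)
  moreover have "odd (card (c \<inter> ?P k)) \<longleftrightarrow> (x \<in> c) \<noteq> (\<alpha> (st x k) \<in> c)"
    using Suc by simp
  moreover have "odd (card (c \<inter> {?a, \<alpha> ?a})) \<longleftrightarrow> (?a \<in> c) \<noteq> (\<alpha> ?a \<in> c)"
    using odd_card_Int_pair[of ?a "\<alpha> ?a" c] \<alpha>_neq[OF a] by metis
  moreover have "?a \<in> c \<longleftrightarrow> \<alpha> (st x k) \<in> c"
    using st_cell[of k x] Suc.prems cell_mem_iff[OF c] by (simp del: funpow.simps)
  ultimately show ?case by argo
qed

section \<open>Potentials separating inside from outside of a triangle\<close>

lemma sides_in: "x \<in> B1 \<Longrightarrow> y \<in> B1 \<Longrightarrow> sides x k y \<subseteq> D"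
  unfolding sides_def using B1_in by auto

text \<open>Invariance under \<open>\<sigma>\<close> makes \<open>h\<close> a function of vertices;
  the condition on \<open>B2\<close> fixes the sign, so that true means inside.\<close>

definition potential :: "('a \<Rightarrow> bool) \<Rightarrow> 'a \<Rightarrow> nat \<Rightarrow> 'a \<Rightarrow> bool" where
  "potential h x k y \<longleftrightarrow> (\<forall>d\<in>D. h (\<sigma> d) = h d) \<and>
     (\<forall>d\<in>D. h (\<alpha> d) \<noteq> h d \<longleftrightarrow> d \<in> sides x k y) \<and> (\<forall>d\<in>B2. \<not> h d)"

context
  fixes x k y
  assumes tri: "triangle x k y"
begin

lemma triangleD: "x \<in> B1" "y \<in> B1" "k < len x" "0 < len y"
  using tri unfolding triangle_def by blast+

lemma tri_SQ: "\<alpha> y \<in> SQ" "\<alpha> (st x k) \<in> SQ"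
  using \<alpha>_B1_SQ len_SQ triangleD by blast+

lemma tri_cell: "orb \<phi> (\<alpha> (st x k)) = orb \<phi> (\<alpha> y)"
  using tri orb_\<phi>_step tri_SQ SQ_in unfolding triangle_def by metis

lemma tri_foot: "foot (\<alpha> y) = y" "foot (\<alpha> (st x k)) = x"
    "foot (\<phi> (\<alpha> y)) = x" "foot (\<phi> (\<alpha> (st x k))) = y"
proof -
  show *: "foot (\<alpha> y) = y" "foot (\<alpha> (st x k)) = x"
    using foot_\<alpha>_B1 triangleD by simp_all
  show "foot (\<phi> (\<alpha> y)) = x" "foot (\<phi> (\<alpha> (st x k))) = y"
    using tri * foot_\<phi>\<phi> tri_SQ unfolding triangle_def by metis+
qed

lemma tri_neq: "x \<noteq> y"
  using foot_neq[OF tri_SQ(1)] tri_foot by simp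

lemma tri_square_foot: "d \<in> orb \<phi> (\<alpha> y) \<Longrightarrow> foot d = x \<or> foot d = y"
  using orb_square[OF tri_SQ(1)] foot_\<phi>\<phi>[OF tri_SQ(1)] foot_\<phi>\<phi>[OF SQ_\<phi>[OF tri_SQ(1)]] tri_foot
  by auto

lemma sidesE:
  assumes "d \<in> sides x k y"
  obtains (path) i where "i \<le> k" "d = st x i \<or> d = \<alpha> (st x i)" "foot d = x"
  | (edge) "d = y \<or> d = \<alpha> y" "foot d = y"
  using assms unfolding sides_def
proof
  assume "d \<in> {d. \<exists>i\<le>k. d = st x i \<or> d = \<alpha> (st x i)}"
  then obtain i where i: "i \<le> k" "d = st x i \<or> d = \<alpha> (st x i)" by blast
  then show ?thesis using path foot_eqI[OF triangleD(1) _ i(2)] triangleD(3) by simp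
next
  assume "d \<in> {y, \<alpha> y}"
  then show ?thesis using edge foot_B1[OF triangleD(2)] tri_foot(1) by blast
qed

lemma sides_cases:
  assumes "d \<in> sides x k y" shows "d = x \<or> d = y \<or> d \<in> SQ"
  using assms
proof (cases rule: sidesE)
  case (path i)
  then show ?thesis
    using st_SQ[of i x] len_SQ[of i x] triangleD(3) by (cases "i = 0") auto
next
  case edge
  then show ?thesis using tri_SQ(1) by blast
qed

lemma sides_B1: "d \<in> B1 \<Longrightarrow> d \<in> sides x k y \<longleftrightarrow> d = x \<or> d = y"
proof
  assume "d \<in> B1" "d \<in> sides x k y"
  then show "d = x \<or> d = y" using sides_cases B1_not_SQ by blast
next
  assume "d = x \<or> d = y"
  moreover have "x \<in> sides x k y" unfolding sides_def by (simp, rule disjI2, rule disjI2, rule exI[of _ 0]) simp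
  ultimately show "d \<in> sides x k y" unfolding sides_def by blast
qed

lemma sides_B2: "d \<in> B2 \<Longrightarrow> d \<notin> sides x k y"
  using sides_cases B2_not_SQ B1_not_B2 triangleD(1,2) by blast

lemma \<alpha>_sides:
  assumes "d \<in> sides x k y" shows "\<alpha> d \<in> sides x k y"
  using assms
proof (cases rule: sidesE)
  case (path i)
  then have "\<alpha> d = st x i \<or> \<alpha> d = \<alpha> (st x i)" using path(2) \<alpha>\<alpha>[OF st_in[OF B1_in[OF triangleD(1)]]] by metis
  then show ?thesis using path(1) unfolding sides_def by blast
next
  case edge
  then have "\<alpha> d = y \<or> \<alpha> d = \<alpha> y" using \<alpha>\<alpha>[OF B1_in[OF triangleD(2)]] by metis
  then show ?thesis unfolding sides_def by blast
qed

text \<open>The strand of \<open>x\<close> leads from \<open>B1\<close> to the apex square and the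
  edge of \<open>y\<close> leads back, so the sides form a closed dual path.\<close>

lemma even_sides:
  assumes c: "c \<in> cells D \<alpha> \<sigma>" shows "even (card (c \<inter> sides x k y))"
proof -
  let ?P = "{d. \<exists>i\<le>k. d = st x i \<or> d = \<alpha> (st x i)}"
  have "foot d = x" if "d \<in> ?P" for d
    using that triangleD(1,3) by auto
  moreover have "foot d \<noteq> x" if "d \<in> {y, \<alpha> y}" for d
    using that foot_B1[OF triangleD(2)] tri_foot(1) tri_neq by auto
  ultimately have disj: "(c \<inter> ?P) \<inter> (c \<inter> {y, \<alpha> y}) = {}" by blast
  have fin_c: "finite c" using cell_subset[OF c] fin by (rule finite_subset)
  have "c \<inter> sides x k y = (c \<inter> ?P) \<union> (c \<inter> {y, \<alpha> y})" unfolding sides_def by blast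
  then have "card (c \<inter> sides x k y) = card (c \<inter> ?P) + card (c \<inter> {y, \<alpha> y})"
    using card_Un_disjoint[OF _ _ disj] fin_c by simp
  then have "odd (card (c \<inter> sides x k y)) \<longleftrightarrow> odd (card (c \<inter> ?P)) \<noteq> odd (card (c \<inter> {y, \<alpha> y}))"
    by (simp only: odd_add)
  moreover have "odd (card (c \<inter> ?P)) \<longleftrightarrow> (x \<in> c) \<noteq> (\<alpha> (st x k) \<in> c)"
    using odd_path[OF triangleD(1) c] triangleD(3) by simp
  moreover have "odd (card (c \<inter> {y, \<alpha> y})) \<longleftrightarrow> (y \<in> c) \<noteq> (\<alpha> y \<in> c)"
    using odd_card_Int_pair[of y "\<alpha> y" c] \<alpha>_neq[OF B1_in[OF triangleD(2)]] by metis
  moreover have "x \<in> c \<longleftrightarrow> y \<in> c"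
    using cell_mem_iff[OF c] cell_orb[OF B1_cell] triangleD(1,2) by simp
  moreover have "\<alpha> (st x k) \<in> c \<longleftrightarrow> \<alpha> y \<in> c"
    using cell_mem_iff[OF c] tri_cell by simp
  ultimately show ?thesis by argo
qed

text \<open>A potential that vanishes at one dart of \<open>B2\<close> vanishes on all of
  \<open>B2\<close>, because no dart of \<open>B2\<close> belongs to a side.\<close>

lemma ex_tri_potential: "\<exists>h. potential h x k y"
proof -
  let ?b = "\<alpha> (st x (len x))"
  have b: "?b \<in> B2" by (rule strand_end_B2[OF triangleD(1)])
  obtain h where h: "\<not> h ?b" "\<forall>d\<in>D. h (\<sigma> d) = h d" "\<forall>d\<in>D. h (\<alpha> d) \<noteq> h d \<longleftrightarrow> d \<in> sides x k y"
    using ex_potential[OF B2_in[OF b] sides_in[OF triangleD(1,2)] \<alpha>_sides even_sides] by blast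
  have out: "\<not> h ((\<phi> ^^ n) ?b) \<and> (\<phi> ^^ n) ?b \<in> B2" for n
  proof (induction n)
    case (Suc n)
    let ?d = "(\<phi> ^^ n) ?b"
    have d: "?d \<in> B2" "\<not> h ?d" using Suc by blast+
    have "h (\<phi> ?d) = h (\<alpha> ?d)" using h(2) \<alpha>_in[OF B2_in[OF d(1)]] unfolding phi_def o_def by blast
    also have "\<dots> = h ?d" using h(3) B2_in[OF d(1)] sides_B2[OF d(1)] by blast
    finally show ?case using d cell_\<phi>[OF B2_cell d(1)] by simp
  qed (use h b in simp)
  have "\<not> h d" if d: "d \<in> B2" for d
  proof -
    have "d \<in> orb \<phi> ?b" using d cell_orb[OF B2_cell b] by simp
    then obtain n where "d = (\<phi> ^^ n) ?b" unfolding orb_def by (rule rangeE)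
    then show ?thesis using out[of n] by simp
  qed
  then show ?thesis unfolding potential_def using h by blast
qed

context
  fixes h
  assumes pot: "potential h x k y"
begin

lemma h_\<sigma>: "d \<in> D \<Longrightarrow> h (\<sigma> d) = h d"
  and h_\<alpha>: "d \<in> D \<Longrightarrow> h (\<alpha> d) \<longleftrightarrow> (h d \<noteq> (d \<in> sides x k y))"
  and h_B2: "d \<in> B2 \<Longrightarrow> \<not> h d"
  using pot unfolding potential_def by blast+

lemma h_\<phi>: "d \<in> D \<Longrightarrow> h (\<phi> d) \<longleftrightarrow> (h d \<noteq> (d \<in> sides x k y))"
  using h_\<sigma>[of "\<alpha> d"] h_\<alpha>[of d] by (simp add: phi_def)

text \<open>The origins of consecutive strand darts are joined by a lateral edge of the square
  between them, namely that of \<open>\<phi> (\<alpha> (st z i))\<close>.\<close>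

lemma h_st_Suc:
  assumes "z \<in> B1" "i < len z"
  shows "h (st z (Suc i)) \<longleftrightarrow> (h (st z i) \<noteq> (\<phi> (\<alpha> (st z i)) \<in> sides x k y))"
proof -
  have D: "st z i \<in> D" "\<phi> (\<alpha> (st z i)) \<in> D" using B1_in[OF assms(1)] by simp_all
  have "h (\<phi> (\<alpha> (st z i))) = h (st z i)" using h_\<sigma>[OF D(1)] \<phi>\<alpha>[OF D(1)] by simp
  then show ?thesis using h_\<phi>[OF D(2)] by (simp add: \<psi>_def)
qed

lemma h_segment:
  assumes z: "z \<in> B1" and "i \<le> j" "j \<le> len z"
    and "\<And>l. i \<le> l \<Longrightarrow> l < j \<Longrightarrow> \<phi> (\<alpha> (st z l)) \<notin> sides x k y"
  shows "h (st z j) = h (st z i)"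
  using assms(2-4)
proof (induction j rule: dec_induct)
  case (step j)
  then show ?case using h_st_Suc[OF z, of j] by (simp del: funpow.simps)
qed simp

lemma h_end:
  assumes z: "z \<in> B1" and "st z (len z) \<notin> sides x k y"
  shows "\<not> h (st z (len z))"
  using h_B2[OF strand_end_B2[OF z]] h_\<alpha>[OF st_in[OF B1_in[OF z]], of "len z"] assms(2) by blast

lemma h_tail:
  assumes z: "z \<in> B1" and i: "i \<le> len z"
    and "\<And>l. i \<le> l \<Longrightarrow> l < len z \<Longrightarrow> \<phi> (\<alpha> (st z l)) \<notin> sides x k y"
    and "st z i \<notin> sides x k y" "st z (len z) \<notin> sides x k y"
  shows "\<not> h (st z i)" "\<not> h (\<alpha> (st z i))"
proof -
  show "\<not> h (st z i)" using h_segment[OF z i order_refl assms(3)] h_end[OF z assms(5)] by simp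
  then show "\<not> h (\<alpha> (st z i))" using h_\<alpha>[OF st_in[OF B1_in[OF z]], of i] assms(4) by simp
qed

text \<open>Crossing the edge of \<open>y\<close> would take place in the apex square, which
  contains only the strands of \<open>x\<close> and \<open>y\<close>.\<close>

lemma crossing_foot:
  assumes z: "z \<in> B1" "z \<noteq> x" "z \<noteq> y" and i: "i < len z" and s: "\<phi> (\<alpha> (st z i)) \<in> sides x k y"
  shows "foot (\<phi> (\<alpha> (st z i))) = x"
  using s
proof (cases rule: sidesE)
  case edge
  have SQ: "\<alpha> (st z i) \<in> SQ" by (rule len_SQ[OF i])
  then have "\<phi> (\<alpha> (st z i)) \<noteq> y" using B1_not_SQ[OF triangleD(2)] SQ_\<phi> by metis
  then have "\<phi> (\<alpha> (st z i)) = \<alpha> y" using edge(1) by blast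
  then have "orb \<phi> (\<alpha> y) = orb \<phi> (\<alpha> (st z i))" using orb_\<phi>_step[OF SQ_in[OF SQ]] by simp
  then have "foot (\<alpha> (st z i)) = x \<or> foot (\<alpha> (st z i)) = y"
    using tri_square_foot orb_self[of "\<alpha> (st z i)" \<phi>] by simp
  then show ?thesis using z foot_\<alpha>_st[OF z(1), of i] i by simp
qed

text \<open>Other strands meet the sides of the triangle at most once, and end outside.\<close>
lemma h_other:
  assumes z: "z \<in> B1" "z \<noteq> x" "z \<noteq> y"
  shows "h z \<longleftrightarrow> (\<exists>i<len z. \<phi> (\<alpha> (st z i)) \<in> sides x k y)"
proof -
  have out: "st z i \<notin> sides x k y" if "i \<le> len z" for i
    using foot_st[OF z(1) that] z(2,3) by (auto elim: sidesE)
  have fin: "\<not> h (st z (len z))" by (rule h_end[OF z(1) out]) simp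
  show ?thesis
  proof (cases "\<exists>i<len z. \<phi> (\<alpha> (st z i)) \<in> sides x k y")
    case False
    then have "h (st z (len z)) = h (st z 0)" by (intro h_segment[OF z(1)]) auto
    then show ?thesis using False fin by simp
  next
    case True
    then obtain i where i: "i < len z" "\<phi> (\<alpha> (st z i)) \<in> sides x k y" by blast
    \<comment> \<open>Every crossing with a side is a crossing with the strand of \<open>x\<close>,
      and there is at most one.\<close>
    have uniq: "l = i" if "l < len z" "\<phi> (\<alpha> (st z l)) \<in> sides x k y" for l
      using cross_unique[OF z(1) that(1) i(1)] crossing_foot[OF z that] crossing_foot[OF z i] by simp
    have "h (st z i) = h (st z 0)"
    proof (rule h_segment[OF z(1)])
      fix l assume l: "0 \<le> l" "l < i"
      then show "\<phi> (\<alpha> (st z l)) \<notin> sides x k y" using uniq[of l] i(1) by linarith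
    qed (use i(1) in simp_all)
    moreover have "h (st z (len z)) = h (st z (Suc i))"
    proof (rule h_segment[OF z(1)])
      fix l assume l: "Suc i \<le> l" "l < len z"
      then show "\<phi> (\<alpha> (st z l)) \<notin> sides x k y" using uniq[of l] by linarith
    qed (use i(1) in simp_all)
    ultimately have "h z" using h_st_Suc[OF z(1) i(1)] i(2) fin by simp
    then show ?thesis using True by blast
  qed
qed

text \<open>The strand of \<open>y\<close> meets that of \<open>x\<close> in its first square,
  number 0, so it cannot cross the side again before it ends at \<open>B2\<close>.\<close>

lemma h_after_y:
  assumes j: "0 < j" "j \<le> len y"
  shows "\<not> h (st y j)" "\<not> h (\<alpha> (st y j))"
proof -
  note y = triangleD(2)
  have out: "st y i \<notin> sides x k y" if i: "0 < i" "i \<le> len y" for i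
  proof
    assume "st y i \<in> sides x k y"
    then show False
    proof (cases rule: sidesE)
      case path
      then show ?thesis using foot_st[OF y i(2)] tri_neq by simp
    next
      case edge
      then show ?thesis
        using st_inj[OF y y i(2), of 0] st_neq_\<alpha>_st[OF y y i(2), of 0] i(1) by simp
    qed
  qed
  have cross: "\<phi> (\<alpha> (st y l)) \<notin> sides x k y" if l: "j \<le> l" "l < len y" for l
  proof
    assume "\<phi> (\<alpha> (st y l)) \<in> sides x k y"
    then have "foot (\<phi> (\<alpha> (st y l))) = x"
    proof (cases rule: sidesE)
      case edge
      then show ?thesis using foot_neq[OF len_SQ[OF l(2)]] foot_\<alpha>_st[OF y, of l] l(2) by simp
    qed
    then have "l = 0" using cross_unique[OF y l(2) triangleD(4)] tri_foot(3) by simp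
    then show False using l j by simp
  qed
  show "\<not> h (st y j)" "\<not> h (\<alpha> (st y j))"
    using h_tail[OF y j(2) cross out[OF j] out[of "len y"]] triangleD(4) by blast+
qed

end

end

section \<open>Corners at smallest triangles, and descent on the base\<close>

definition base :: "('a \<Rightarrow> bool) \<Rightarrow> 'a \<Rightarrow> 'a \<Rightarrow> 'a set" where
  "base h x y = {d \<in> B1. d \<noteq> x \<and> d \<noteq> y \<and> h d}"

text \<open>The edges of \<open>x\<close> and \<open>y\<close> share a vertex of the apex square.
  Once \<open>\<phi> x = y\<close>, the rotation at that vertex closes up after two darts.\<close>

lemma corner:
  assumes tri: "triangle x 0 y" and adjacent: "\<alpha> x = \<phi> (\<alpha> y)"
  shows "has_corner_on D \<alpha> \<sigma> B1 B2 B1"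
proof -
  note T = triangleD[OF tri]
  obtain h where pot: "potential h x 0 y" using ex_tri_potential[OF tri] by blast
  have D: "x \<in> D" "y \<in> D" using T B1_in by blast+
  have \<sigma>y: "\<sigma> y = \<alpha> x" using adjacent \<phi>\<alpha>[OF D(2)] by simp
  have \<sigma>x: "\<sigma> (\<alpha> x) = \<phi> x" by (simp add: phi_def)
  have "\<phi> (\<alpha> y) \<in> sides x 0 y" unfolding adjacent[symmetric] sides_def by auto
  then have "h (st y (Suc 0)) \<longleftrightarrow> \<not> h y"
    using h_st_Suc[OF tri pot T(2) T(4)] by simp
  \<comment> \<open>The first step along \<open>y\<close> crosses the side at
    \<open>\<alpha> x\<close> and arrives outside, so it started inside.\<close>
  then have hy: "h y" using h_after_y(1)[OF tri pot, of "Suc 0"] T(4) by simp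
  have h\<alpha>x: "h (\<alpha> x)" using h_\<sigma>[OF tri pot D(2)] \<sigma>y hy by simp
  have hz: "h (\<phi> x)" using h_\<sigma>[OF tri pot, of "\<alpha> x"] \<sigma>x h\<alpha>x D by simp
  have z: "\<phi> x \<in> B1" by (rule cell_\<phi>[OF B1_cell T(1)])
  have "x \<in> sides x 0 y" using sides_B1[OF tri T(1)] by simp
  then have "\<not> h x" using h_\<alpha>[OF tri pot D(1)] h\<alpha>x by simp
  then have "\<phi> x \<noteq> x" using hz by metis
  have "\<phi> x = y"
  proof (rule ccontr)
    assume "\<phi> x \<noteq> y"
    \<comment> \<open>A third strand starting inside must leave through a side. With
      \<open>k = 0\<close> the squares at the sides reduce to the apex square, where only
      \<open>x\<close> and \<open>y\<close> pass.\<close>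
    then obtain i where i: "i < len (\<phi> x)" "\<phi> (\<alpha> (st (\<phi> x) i)) \<in> sides x 0 y"
      using h_other[OF tri pot z \<open>\<phi> x \<noteq> x\<close>] hz by blast
    let ?a = "\<alpha> (st (\<phi> x) i)"
    have SQ: "?a \<in> SQ" by (rule len_SQ[OF i(1)])
    have "\<phi> ?a \<in> orb \<phi> (\<alpha> y)"
      using i(2)
    proof (cases rule: sidesE[OF tri, consumes 1, case_names path edge])
      case (path j)
      then have "\<phi> ?a = \<alpha> x" using B1_not_SQ[OF T(1)] SQ_\<phi>[OF SQ] by auto
      then show ?thesis using orb_step[OF orb_self] adjacent by metis
    next
      case edge
      then have "\<phi> ?a = \<alpha> y" using B1_not_SQ[OF T(2)] SQ_\<phi>[OF SQ] by auto
      then show ?thesis using orb_self by metis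
    qed
    then have "orb \<phi> ?a = orb \<phi> (\<alpha> y)"
      using orb_\<phi>_eq[OF SQ_in[OF tri_SQ(1)[OF tri]]] orb_\<phi>_step[OF SQ_in[OF SQ]] by metis
    then have "foot ?a = x \<or> foot ?a = y" using tri_square_foot[OF tri] orb_self[of ?a \<phi>] by simp
    moreover have "foot ?a = \<phi> x" using foot_\<alpha>_st[OF z, of i] i(1) by simp
    ultimately show False using \<open>\<phi> x \<noteq> x\<close> \<open>\<phi> x \<noteq> y\<close> by simp
  qed
  then have \<sigma>\<alpha>x: "\<sigma> (\<alpha> x) = y" using \<sigma>x by simp
  have "(\<sigma> ^^ n) y \<in> {y, \<alpha> x}" for n
    by (induction n) (use \<sigma>y \<sigma>\<alpha>x in auto)
  then have "orb \<sigma> y = {y, \<alpha> x}"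
    using orb_self[of y \<sigma>] orb_step[OF orb_self, of \<sigma> y] \<sigma>y by (auto simp: orb_def)
  moreover have "y \<noteq> \<alpha> x"
    using B1_not_SQ[OF T(2)] tri_SQ(2)[OF tri] by auto
  ultimately have "card (orb \<sigma> y) = 2" by simp
  moreover have "orb \<sigma> y \<in> verts D \<sigma>" using D(2) by (simp add: verts_def)
  moreover have "orb \<phi> (\<alpha> y) \<in> sqs" by (rule SQ_orb[OF tri_SQ(1)[OF tri]])
  moreover have "\<alpha> x \<in> orb \<phi> (\<alpha> y)" unfolding adjacent by (rule orb_step[OF orb_self])
  moreover have "orb \<sigma> (\<alpha> x) = orb \<sigma> y" using orb_\<sigma>_step[OF D(2)] \<sigma>y by simp
  ultimately show ?thesis unfolding has_corner_on_def using T(2) by blast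
qed

lemma triangle_swap: "triangle x 0 y \<Longrightarrow> triangle y 0 x"
  unfolding triangle_def by auto

text \<open>The bases are compared along the boundary path numbered from \<open>x\<close>: on the
  remaining darts \<open>h\<close> switches only at \<open>y\<close>, and \<open>h'\<close> only at
  \<open>z\<close>.\<close>

lemma triangle_descent:
  assumes tri: "triangle x k y" and pot: "potential h x k y" and k: "0 < k"
  shows "\<exists>z j h'. triangle z j x \<and> potential h' z j x \<and> base h' z x \<subset> base h x y"
proof -
  note T = triangleD[OF tri]
  obtain z j where tri': "triangle z j x" using ex_triangle[OF T(1)] T(3) by auto
  note T' = triangleD[OF tri']
  obtain h' where pot': "potential h' z j x" using ex_tri_potential[OF tri'] by blast
  have zx: "z \<noteq> x" by (rule tri_neq[OF tri'])
  have zy: "z \<noteq> y"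
  proof
    assume "z = y"
    \<comment> \<open>Otherwise \<open>x\<close> would cross \<open>y\<close> both in its first
      square and in the apex square, number \<open>k > 0\<close>.\<close>
    then have "foot (\<phi> (\<alpha> (st x 0))) = foot (\<phi> (\<alpha> (st x k)))"
      using tri_foot(3)[OF tri'] tri_foot(4)[OF tri] by simp
    then show False using cross_unique[OF T(1) T'(4) T(3)] k by simp
  qed
  have xy: "x \<noteq> y" by (rule tri_neq[OF tri])
  \<comment> \<open>\<open>z\<close> crosses between the edges number 0 and 1 of \<open>x\<close>;
    as \<open>0 < k\<close>, both are part of the old side.\<close>
  have "\<phi> (\<alpha> (st z j)) = \<alpha> (st x 0) \<or> \<phi> (\<alpha> (st z j)) = st x (Suc 0)"
    using tri' unfolding triangle_def by (auto simp: \<psi>_def)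
  then have "\<phi> (\<alpha> (st z j)) \<in> sides x k y"
    using k unfolding sides_def by (metis (mono_tags, lifting) CollectI Suc_leI UnI1 zero_le)
  then have hz: "h z" using h_other[OF tri pot T'(1) zx zy] T'(3) by blast
  have h'x: "\<not> h' (st x k)" "\<not> h' (\<alpha> (st x k))"
    using h_after_y[OF tri' pot' k] T(3) by simp_all
  have D: "x \<in> D" "y \<in> D" "st x k \<in> D" using T B1_in by auto
  \<comment> \<open>The edges of \<open>y\<close> and \<open>st x k\<close> share a vertex. Edge
    number \<open>k\<close> of \<open>x\<close> lies past the first square, hence outside the new
    triangle, and so does \<open>y\<close>.\<close>
  have "\<alpha> (st x k) = \<sigma> y \<or> \<alpha> y = \<sigma> (st x k)"
    using tri \<phi>\<alpha>[OF D(2)] \<phi>\<alpha>[OF D(3)] unfolding triangle_def by simp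
  then have h'y: "\<not> h' y"
  proof
    assume "\<alpha> (st x k) = \<sigma> y"
    then show ?thesis using h_\<sigma>[OF tri' pot' D(2)] h'x by simp
  next
    assume "\<alpha> y = \<sigma> (st x k)"
    then have "\<not> h' (\<alpha> y)" using h_\<sigma>[OF tri' pot' D(3)] h'x by simp
    moreover have "y \<notin> sides z j x" using sides_B1[OF tri' T(2)] zy xy by simp
    ultimately show ?thesis using h_\<alpha>[OF tri' pot' D(2)] by simp
  qed
  define n where "n = card (orb \<phi> x)"
  define b where "b i = (\<phi> ^^ i) x" for i
  note cyc = orb_cycle[OF fin bij_\<phi> D(1), folded n_def b_def]
  have B1: "B1 = b ` {..<n}" using cyc(4) cell_orb[OF B1_cell T(1)] by (simp add: b_def[abs_def])
  have bB1: "b i \<in> B1" for i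
    using cell_orb[OF B1_cell T(1)] by (auto simp: orb_def b_def)
  have b_inj: "b i = b l \<longleftrightarrow> i = l" if "i < n" "l < n" for i l
    using cyc(3) that unfolding b_def by (auto dest: inj_onD)
  have b0: "b 0 = x" by (simp add: b_def)
  have pos: "\<exists>i. 0 < i \<and> i < n \<and> d = b i" if d: "d \<in> B1" "d \<noteq> x" for d
  proof -
    obtain i where "i < n" "d = b i" using d(1) B1 by auto
    moreover have "i \<noteq> 0" using d(2) b0 \<open>d = b i\<close> by metis
    ultimately show ?thesis by blast
  qed
  obtain q where q: "0 < q" "q < n" "y = b q" using pos[OF T(2)] xy by blast
  obtain r where r: "0 < r" "r < n" "z = b r" using pos[OF T'(1) zx] by blast
  have hb: "h (b i) \<longleftrightarrow> (h (b 1) \<noteq> (q < i))" if i: "0 < i" "i < n" for i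
  proof (rule switch_once[of n "\<lambda>i. h (b i)" q])
    fix i assume i: "0 < i" "i < n"
    have "b i \<in> sides x k y \<longleftrightarrow> i = q"
      using sides_B1[OF tri bB1] b_inj[of i q] b_inj[of i 0] b0 i q by auto
    then show "h (b (Suc i)) \<longleftrightarrow> (h (b i) \<noteq> (i = q))"
      using h_\<phi>[OF tri pot B1_in[OF bB1], of i] by (simp add: b_def)
  qed (use i q in auto)
  have hb': "h' (b i) \<longleftrightarrow> (h' (b 1) \<noteq> (r < i))" if i: "0 < i" "i < n" for i
  proof (rule switch_once[of n "\<lambda>i. h' (b i)" r])
    fix i assume i: "0 < i" "i < n"
    have "b i \<in> sides z j x \<longleftrightarrow> i = r"
      using sides_B1[OF tri' bB1] b_inj[of i r] b_inj[of i 0] b0 i r by auto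
    then show "h' (b (Suc i)) \<longleftrightarrow> (h' (b i) \<noteq> (i = r))"
      using h_\<phi>[OF tri' pot' B1_in[OF bB1], of i] by (simp add: b_def)
  qed (use i r in auto)
  have "base h' z x \<subseteq> base h x y"
  proof
    fix d assume "d \<in> base h' z x"
    then have d: "d \<in> B1" "d \<noteq> z" "d \<noteq> x" "h' d" unfolding base_def by auto
    obtain t where t: "0 < t" "t < n" "d = b t" using pos[OF d(1,3)] by blast
    have "t \<noteq> r" using d(2) t r by auto
    have "q \<noteq> r" using zy q r by auto
    \<comment> \<open>These three facts say that \<open>z\<close> is inside the old triangle,
      \<open>y\<close> outside the new one, and \<open>d\<close> inside the new one. If
      \<open>r < q\<close> then \<open>t < r < q\<close>, and if \<open>q < r\<close> then
      \<open>q < r < t\<close>; in both cases \<open>d\<close> and \<open>z\<close> lie on the same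
      side of \<open>y\<close>.\<close>
    have "h (b 1) \<noteq> (q < r)" using hb[OF r(1,2)] hz r(3) by simp
    moreover have "h' (b 1) \<longleftrightarrow> r < q" using hb'[OF q(1,2)] h'y q(3) by simp
    moreover have "h' (b 1) \<noteq> (r < t)" using hb'[OF t(1,2)] d(4) t(3) by simp
    ultimately have "h (b 1) \<noteq> (q < t)" using \<open>q \<noteq> r\<close> by linarith
    then have "h d" using hb[OF t(1,2)] t(3) by simp
    moreover have "d \<noteq> y" using d(4) h'y by metis
    ultimately show "d \<in> base h x y" using d unfolding base_def by simp
  qed
  moreover have "z \<in> base h x y" "z \<notin> base h' z x"
    using T'(1) zx zy hz unfolding base_def by auto
  ultimately show ?thesis using tri' pot' by blast
qed

lemma triangle_corner:
  assumes "triangle x k y" "potential h x k y"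
  shows "has_corner_on D \<alpha> \<sigma> B1 B2 B1"
  using assms
proof (induction "card (base h x y)" arbitrary: x k y h rule: less_induct)
  case less
  show ?case
  proof (cases "k = 0")
    case True
    then have tri: "triangle x 0 y" using less.prems(1) by simp
    then have "\<alpha> x = \<phi> (\<alpha> y) \<or> \<alpha> y = \<phi> (\<alpha> x)" unfolding triangle_def by simp
    then show ?thesis using corner[OF tri] corner[OF triangle_swap[OF tri]] by blast
  next
    case False
    then obtain z j h' where z: "triangle z j x" "potential h' z j x" "base h' z x \<subset> base h x y"
      using triangle_descent[OF less.prems] by blast
    have "base h x y \<subseteq> D" using B1_in unfolding base_def by blast
    then have "finite (base h x y)" using fin by (rule finite_subset)
    then have "card (base h' z x) < card (base h x y)" using z(3) by (rule psubset_card_mono)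
    then show ?thesis using less.hyps z(1,2) by blast
  qed
qed

text \<open>A dart of any square lies on a strand of positive length, and such a strand supplies the
  initial triangle.\<close>

lemma squares_imp_corner:
  assumes "sqs \<noteq> {}" shows "has_corner_on D \<alpha> \<sigma> B1 B2 B1"
proof -
  obtain s where "s \<in> sqs" using assms by blast
  moreover from this obtain d where "d \<in> D" "s = orb \<phi> d"
    unfolding squares_def cells_def by blast
  ultimately have d: "d \<in> SQ" unfolding SQ_def by blast
  obtain p i where p: "p \<in> B1" "i \<le> len p" "d = st p i \<or> d = \<alpha> (st p i)"
    using strand_cover[OF SQ_in[OF d]] .
  from p(1,2) d p(3) have "0 < len p"
    by (cases rule: \<alpha>_SQ_cases) (use p(2) in auto)
  then obtain x k where tri: "triangle x k p" using ex_triangle[OF p(1)] by blast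
  then obtain h where "potential h x k p" using ex_tri_potential by blast
  then show ?thesis using triangle_corner tri by blast
qed

end

section \<open>Exchanging the two boundary paths\<close>

lemma squares_swap: "squares D \<alpha> \<sigma> B2 B1 = squares D \<alpha> \<sigma> B1 B2"
  by (simp add: squares_def insert_commute)

text \<open>The boundary cells enter the notions of curves only through \<open>squares\<close>; in
  \<open>joins_boundaries\<close> the two end edges form an unordered pair and can be
  exchanged.\<close>

lemma k_system_annular_diagram_swap:
  assumes "k_system_annular_diagram k D \<alpha> \<sigma> B1 B2"
  shows "k_system_annular_diagram k D \<alpha> \<sigma> B2 B1"
proof -
  have mc: "midcubes D \<alpha> \<sigma> B2 B1 = midcubes D \<alpha> \<sigma> B1 B2"
    unfolding midcubes_def squares_swap[of D \<alpha> \<sigma> B2] ..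
  have cm: "curve_mcs D \<alpha> \<sigma> B2 B1 = curve_mcs D \<alpha> \<sigma> B1 B2"
    by (intro ext) (simp only: curve_mcs_def mc)
  have cd: "curve_deg D \<alpha> \<sigma> B2 B1 = curve_deg D \<alpha> \<sigma> B1 B2"
    by (intro ext) (simp only: curve_deg_def cm)
  have "U_adj D \<alpha> \<sigma> B2 B1 = U_adj D \<alpha> \<sigma> B1 B2"
    by (intro ext) (simp only: U_adj_def mc)
  then have dc: "dual_curves D \<alpha> \<sigma> B2 B1 = dual_curves D \<alpha> \<sigma> B1 B2"
    by (simp only: dual_curves_def)
  have ms: "meet_squares D \<alpha> \<sigma> B2 B1 = meet_squares D \<alpha> \<sigma> B1 B2"
    by (intro ext) (simp only: meet_squares_def cm squares_swap[of D \<alpha> \<sigma> B2])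
  have arc: "is_arc D \<alpha> \<sigma> B2 B1 = is_arc D \<alpha> \<sigma> B1 B2"
    by (intro ext) (simp only: is_arc_def cm cd)
  have simple: "is_simple D \<alpha> \<sigma> B2 B1 = is_simple D \<alpha> \<sigma> B1 B2"
    by (intro ext) (simp only: is_simple_def cm)
  have "arc_ends D \<alpha> \<sigma> B2 B1 = arc_ends D \<alpha> \<sigma> B1 B2"
    by (intro ext) (simp only: arc_ends_def cd)
  then have joins: "joins_boundaries D \<alpha> \<sigma> B2 B1 C" if "joins_boundaries D \<alpha> \<sigma> B1 B2 C" for C
    using that unfolding joins_boundaries_def by (metis insert_commute)
  have "square_annular_diagram D \<alpha> \<sigma> B2 B1"
    using assms unfolding k_system_annular_diagram_def square_annular_diagram_def
      squares_swap[of D \<alpha> \<sigma> B2] by blast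
  then show ?thesis
    using assms joins unfolding k_system_annular_diagram_def dc ms arc simple by blast
qed

theorem theorem1p4:
  fixes D :: "'d set" and \<alpha> \<sigma> :: "'d \<Rightarrow> 'd" and B1 B2 :: "'d set"
  assumes "k_system_annular_diagram 1 D \<alpha> \<sigma> B1 B2"
  shows "squares D \<alpha> \<sigma> B1 B2 = {} \<or>
         (has_corner_on D \<alpha> \<sigma> B1 B2 B1 \<and> has_corner_on D \<alpha> \<sigma> B1 B2 B2)"
proof -
  have sphere: "sphere_map D \<alpha> \<sigma>"
    using assms unfolding k_system_annular_diagram_def square_annular_diagram_def by blast
  interpret one: one_system D \<alpha> \<sigma> B1 B2
    using sphere assms by unfold_locales
  interpret two: one_system D \<alpha> \<sigma> B2 B1
    using sphere k_system_annular_diagram_swap[OF assms] by unfold_locales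
  have "has_corner_on D \<alpha> \<sigma> B2 B1 B2 = has_corner_on D \<alpha> \<sigma> B1 B2 B2"
    unfolding has_corner_on_def squares_swap[of D \<alpha> \<sigma> B2] ..
  then show ?thesis
    using one.squares_imp_corner two.squares_imp_corner squares_swap[of D \<alpha> \<sigma> B2 B1] by auto
qed

end
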